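(* Let $m,n\ge 2$ be integers. The set $\mathcal{R}_0$ of all R$_0$-tensors is semi-algebraic in $\mathbb{R}^{[m,n]}$.
   Context: $\mathbb{R}^{[m,n]}\cong\mathbb{R}^{n^m}$ is the real vector space of real $m$-th order $n$-dimensional tensors $\mathcal{A}=(a_{i_1\cdots i_m})$, $i_j\in[n]=\{1,\dots,n\}$. For $x\in\mathbb{R}^n$, $\mathcal{A}x^{m-1}\in\mathbb{R}^n$ has components $(\mathcal{A}x^{m-1})_i=\sum_{i_2,\dots,i_m=1}^n a_{ii_2\cdots i_m}x_{i_2}\cdots x_{i_m}$, and $\mathcal{A}x^m=\langle x,\mathcal{A}x^{m-1}\rangle$. For $a\in\mathbb{R}^n$, $\mathrm{Sol}(\mathcal{A},a)$ is the solution set of the tensor complementarity problem $\mathrm{TCP}(\mathcal{A},a)$, i.e. the set of $x\in\mathbb{R}^n$ with $x\ge 0$, $\mathcal{A}x^{m-1}+a\ge 0$, $\mathcal{A}x^m+\langle x,a\rangle=0$ (inequalities componentwise). $\mathcal{A}$ is an R$_0$-tensor if $\mathrm{Sol}(\mathcal{A},0)=\{0\}$; $\mathcal{R}_0\subset\mathbb{R}^{[m,n]}$ is the set of all R$_0$-tensors. A subset of $\mathbb{R}^N$ is semi-algebraic if it is a finite union of sets of the form $\{x: f_1(x)=\dots=f_\ell(x)=0,\ g_{\ell+1}(x)<0,\dots,g_k(x)<0\}$ with $f_i,g_j$ real polynomials. *)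

theory Defs
  imports Complex_Main "HOL-Library.FuncSet" "HOL-Library.Poly_Mapping"
begin

section \<open>Real coordinate spaces and semi-algebraic sets\<close>

text \<open>
  For a finite index set \<open>I\<close>, the space of real families \<open>(x\<^sub>i)\<close> with \<open>i \<in> I\<close> is the set of
  functions that are extensional on \<open>I\<close>, so that equality of functions is equality of all
  coordinates. With \<open>card I = N\<close> it is the \<open>N\<close>-dimensional real coordinate space, the
  coordinates being labelled by \<open>I\<close> instead of by \<open>1, \<dots>, N\<close>.
\<close>

definition coord_space :: "'i set \<Rightarrow> ('i \<Rightarrow> real) set" where
  "coord_space I = (I \<rightarrow>\<^sub>E (UNIV :: real set))"

text \<open>
  Real polynomials in variables of type \<open>'i\<close>: finitely supported maps from monomials
  to coefficients, a monomial being a finitely supported map from variables to exponents.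
\<close>

type_synonym 'i real_mpoly = "('i \<Rightarrow>\<^sub>0 nat) \<Rightarrow>\<^sub>0 real"

definition mpoly_vars :: "'i real_mpoly \<Rightarrow> 'i set" where
  "mpoly_vars p = (\<Union>t \<in> Poly_Mapping.keys p. Poly_Mapping.keys t)"

definition mpoly_eval :: "'i real_mpoly \<Rightarrow> ('i \<Rightarrow> real) \<Rightarrow> real" where
  "mpoly_eval p x =
     (\<Sum>t \<in> Poly_Mapping.keys p. Poly_Mapping.lookup p t *
        (\<Prod>i \<in> Poly_Mapping.keys t. x i ^ Poly_Mapping.lookup t i))"

definition basic_semialgebraic :: "'i set \<Rightarrow> ('i \<Rightarrow> real) set \<Rightarrow> bool" where
  "basic_semialgebraic I B \<longleftrightarrow>
     (\<exists>F G :: 'i real_mpoly set.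
        finite F \<and> finite G \<and>
        (\<forall>p \<in> F \<union> G. mpoly_vars p \<subseteq> I) \<and>
        B = {x \<in> coord_space I. (\<forall>f\<in>F. mpoly_eval f x = 0) \<and> (\<forall>g\<in>G. mpoly_eval g x < 0)})"

definition semialgebraic :: "'i set \<Rightarrow> ('i \<Rightarrow> real) set \<Rightarrow> bool" where
  "semialgebraic I S \<longleftrightarrow>
     (\<exists>\<B>. finite \<B> \<and> (\<forall>B\<in>\<B>. basic_semialgebraic I B) \<and> S = \<Union>\<B>)"

section \<open>Tensors and tensor complementarity problems\<close>

definition multi_indices :: "nat \<Rightarrow> nat \<Rightarrow> nat list set" where
  "multi_indices m n = {is. length is = m \<and> set is \<subseteq> {1..n}}"

definition real_vectors :: "nat \<Rightarrow> (nat \<Rightarrow> real) set" where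
  "real_vectors n = coord_space {1..n}"

definition zero_vector :: "nat \<Rightarrow> nat \<Rightarrow> real" where
  "zero_vector n = (\<lambda>i\<in>{1..n}. 0)"

definition inner_vec :: "nat \<Rightarrow> (nat \<Rightarrow> real) \<Rightarrow> (nat \<Rightarrow> real) \<Rightarrow> real" where
  "inner_vec n x y = (\<Sum>i = 1..n. x i * y i)"

definition tensors :: "nat \<Rightarrow> nat \<Rightarrow> (nat list \<Rightarrow> real) set" where
  "tensors m n = coord_space (multi_indices m n)"

text \<open>The vector \<open>A x\<^sup>m\<^sup>-\<^sup>1\<close>; here \<open>js\<close> ranges over the tuples \<open>(i\<^sub>2, \<dots>, i\<^sub>m)\<close>.\<close>

definition tensor_apply ::
    "nat \<Rightarrow> nat \<Rightarrow> (nat list \<Rightarrow> real) \<Rightarrow> (nat \<Rightarrow> real) \<Rightarrow> (nat \<Rightarrow> real)" where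
  "tensor_apply m n A x =
     (\<lambda>i\<in>{1..n}. \<Sum>js \<in> multi_indices (m - 1) n. A (i # js) * (\<Prod>j\<leftarrow>js. x j))"

text \<open>The scalar \<open>A x\<^sup>m\<close>.\<close>

definition tensor_form ::
    "nat \<Rightarrow> nat \<Rightarrow> (nat list \<Rightarrow> real) \<Rightarrow> (nat \<Rightarrow> real) \<Rightarrow> real" where
  "tensor_form m n A x = inner_vec n x (tensor_apply m n A x)"

definition TCP_Sol ::
    "nat \<Rightarrow> nat \<Rightarrow> (nat list \<Rightarrow> real) \<Rightarrow> (nat \<Rightarrow> real) \<Rightarrow> (nat \<Rightarrow> real) set" where
  "TCP_Sol m n A a =
     {x \<in> real_vectors n.
        (\<forall>i\<in>{1..n}. x i \<ge> 0) \<and>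
        (\<forall>i\<in>{1..n}. tensor_apply m n A x i + a i \<ge> 0) \<and>
        tensor_form m n A x + inner_vec n x a = 0}"

definition R0_tensor :: "nat \<Rightarrow> nat \<Rightarrow> (nat list \<Rightarrow> real) \<Rightarrow> bool" where
  "R0_tensor m n A \<longleftrightarrow> TCP_Sol m n A (zero_vector n) = {zero_vector n}"

definition R0_set :: "nat \<Rightarrow> nat \<Rightarrow> (nat list \<Rightarrow> real) set" where
  "R0_set m n = {A \<in> tensors m n. R0_tensor m n A}"

end

theory Submission
  imports Defs
begin

text \<open>
  The complement of the set of R0-tensors is the projection, along the vector \<open>x\<close>, of a
  semi-algebraic set, so the theorem is an instance of the Tarski-Seidenberg theorem. The latter is
  proved with the sign tables of Cohen and Hoermander. A sign table of a finite family of
  univariate polynomials lists the signs of all of them at finitely many points that include their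
  roots, and on the intervals in between. The table of a family with a polynomial \<open>q\<close> of maximal
  degree can be computed from the table in which \<open>q\<close> is replaced by its derivative and its
  pseudo-remainders modulo the other polynomials and the derivative: the remainders give the sign
  of \<open>q\<close> at the roots of the others, and between two consecutive such points \<open>q\<close> is monotone,
  so it has a root there iff its signs at the two ends are opposite. When the coefficients
  depend polynomially on parameters, the only additional information needed is which leading
  coefficients vanish; hence the table is a function of the signs of finitely many polynomials in
  the parameters.
\<close>

section \<open>Polynomial functions\<close>

text \<open>Monomials outside the support have coefficient zero. A common larger index set makes
  sums over different supports comparable.\<close>

lemma mpoly_eval_superset:
  assumes "finite K" "Poly_Mapping.keys p \<subseteq> K"
  shows "mpoly_eval p x =
    (\<Sum>t\<in>K. Poly_Mapping.lookup p t * (\<Prod>i\<in>Poly_Mapping.keys t. x i ^ Poly_Mapping.lookup t i))"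
  unfolding mpoly_eval_def using assms
  by (intro sum.mono_neutral_left) (auto simp: in_keys_iff)

lemma mpoly_eval_single:
  "mpoly_eval (Poly_Mapping.single t c) x = c * (\<Prod>i\<in>Poly_Mapping.keys t. x i ^ Poly_Mapping.lookup t i)"
  by (subst mpoly_eval_superset[of "{t}"]) (auto simp: in_keys_iff)

lemma mpoly_eval_add: "mpoly_eval (p + q) x = mpoly_eval p x + mpoly_eval q x"
proof -
  let ?K = "Poly_Mapping.keys p \<union> Poly_Mapping.keys q"
  show ?thesis
    using mpoly_eval_superset[of ?K "p + q" x] mpoly_eval_superset[of ?K p x]
      mpoly_eval_superset[of ?K q x] Poly_Mapping.keys_add[of p q]
    by (simp add: lookup_add distrib_right sum.distrib)
qed

lemma monomial_value_add:
  fixes s t :: "'i \<Rightarrow>\<^sub>0 nat" and x :: "'i \<Rightarrow> real"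
  shows "(\<Prod>i\<in>Poly_Mapping.keys (s + t). x i ^ Poly_Mapping.lookup (s + t) i) =
    (\<Prod>i\<in>Poly_Mapping.keys s. x i ^ Poly_Mapping.lookup s i) *
    (\<Prod>i\<in>Poly_Mapping.keys t. x i ^ Poly_Mapping.lookup t i)"
proof -
  let ?K = "Poly_Mapping.keys s \<union> Poly_Mapping.keys t"
  have ext: "(\<Prod>i\<in>Poly_Mapping.keys r. x i ^ Poly_Mapping.lookup r i) =
      (\<Prod>i\<in>?K. x i ^ Poly_Mapping.lookup r i)"
    if "Poly_Mapping.keys r \<subseteq> ?K" for r
    using that by (intro prod.mono_neutral_left) (auto simp: in_keys_iff)
  show ?thesis
    using ext[of s] ext[of t] ext[of "s + t"] Poly_Mapping.keys_add[of s t]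
    by (simp add: lookup_add power_add prod.distrib)
qed

text \<open>Reduces additive claims, such as multiplicativity of evaluation, to monomials; the zero
  polynomial is the monomial with coefficient 0.\<close>

lemma mpoly_induct [case_names single add]:
  fixes p :: "'i real_mpoly"
  assumes single: "\<And>t c. P (Poly_Mapping.single t c)"
    and add: "\<And>p q. P p \<Longrightarrow> P q \<Longrightarrow> P (p + q)"
  shows "P p"
proof (induction p rule: update_induct)
  case const
  show ?case using single[of 0 0] by simp
next
  case (update f a b)
  have "Poly_Mapping.update a b f = f + Poly_Mapping.single a b"
    using update.hyps by (intro poly_mapping_eqI) (auto simp: lookup_update lookup_add lookup_single in_keys_iff when_def)
  then show ?case using add[OF update.IH single] by simp
qed

lemma mpoly_eval_mult: "mpoly_eval (p * q) x = mpoly_eval p x * mpoly_eval q x"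
proof (induction p rule: mpoly_induct)
  case (single t c)
  show ?case
    by (induction q rule: mpoly_induct)
      (simp_all add: distrib_left mpoly_eval_add mult_single mpoly_eval_single monomial_value_add)
next
  case (add p1 p2)
  then show ?case by (simp add: distrib_right mpoly_eval_add)
qed

section \<open>Closure properties of polynomial functions\<close>

text \<open>Working with functions avoids carrying representing polynomials and their variables
  through the later constructions.\<close>

definition polyfun :: "'i set \<Rightarrow> (('i \<Rightarrow> real) \<Rightarrow> real) set" where
  "polyfun I = {mpoly_eval p | p. mpoly_vars p \<subseteq> I}"

lemma polyfun_add:
  assumes "f \<in> polyfun I" "g \<in> polyfun I"
  shows "(\<lambda>x. f x + g x) \<in> polyfun I"
proof -
  obtain p q where p: "f = mpoly_eval p" "mpoly_vars p \<subseteq> I" and q: "g = mpoly_eval q" "mpoly_vars q \<subseteq> I"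
    using assms by (auto simp: polyfun_def)
  have "mpoly_vars (p + q) \<subseteq> I"
    using p q Poly_Mapping.keys_add[of p q] unfolding mpoly_vars_def by blast
  moreover have "(\<lambda>x. f x + g x) = mpoly_eval (p + q)"
    by (simp add: p q mpoly_eval_add fun_eq_iff)
  ultimately show ?thesis by (auto simp: polyfun_def)
qed

lemma polyfun_mult:
  assumes "f \<in> polyfun I" "g \<in> polyfun I"
  shows "(\<lambda>x. f x * g x) \<in> polyfun I"
proof -
  obtain p q where p: "f = mpoly_eval p" "mpoly_vars p \<subseteq> I" and q: "g = mpoly_eval q" "mpoly_vars q \<subseteq> I"
    using assms by (auto simp: polyfun_def)
  have "Poly_Mapping.keys t \<subseteq> I" if t: "t \<in> Poly_Mapping.keys (p * q)" for t
  proof -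
    obtain a b where "t = a + b" "a \<in> Poly_Mapping.keys p" "b \<in> Poly_Mapping.keys q"
      using Poly_Mapping.keys_mult[of p q] t by blast
    then show ?thesis
      using p q Poly_Mapping.keys_add[of a b] unfolding mpoly_vars_def by blast
  qed
  then have "mpoly_vars (p * q) \<subseteq> I" by (auto simp: mpoly_vars_def)
  moreover have "(\<lambda>x. f x * g x) = mpoly_eval (p * q)"
    by (simp add: p q mpoly_eval_mult fun_eq_iff)
  ultimately show ?thesis by (auto simp: polyfun_def)
qed

lemma polyfun_const: "(\<lambda>x. c) \<in> polyfun I"
  unfolding polyfun_def mem_Collect_eq
  by (rule exI[of _ "Poly_Mapping.single 0 c"])
    (simp add: fun_eq_iff mpoly_eval_single mpoly_vars_def)

lemma polyfun_coord:
  assumes "i \<in> I"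
  shows "(\<lambda>x. x i) \<in> polyfun I"
  unfolding polyfun_def mem_Collect_eq
  by (rule exI[of _ "Poly_Mapping.single (Poly_Mapping.single i 1) 1"])
    (use assms in \<open>simp add: fun_eq_iff mpoly_eval_single mpoly_vars_def\<close>)

lemma polyfun_minus: "f \<in> polyfun I \<Longrightarrow> (\<lambda>x. - f x) \<in> polyfun I"
  using polyfun_mult[OF polyfun_const[of "-1"], of f] by simp

lemma polyfun_power: "f \<in> polyfun I \<Longrightarrow> (\<lambda>x. f x ^ k) \<in> polyfun I"
  by (induction k) (auto intro: polyfun_const polyfun_mult)

lemma polyfun_sum:
  assumes "\<And>k. k \<in> K \<Longrightarrow> f k \<in> polyfun I"
  shows "(\<lambda>x. \<Sum>k\<in>K. f k x) \<in> polyfun I"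
  using assms by (induction K rule: infinite_finite_induct) (auto intro: polyfun_const polyfun_add)

lemma polyfun_prod:
  assumes "\<And>k. k \<in> K \<Longrightarrow> f k \<in> polyfun I"
  shows "(\<lambda>x. \<Prod>k\<in>K. f k x) \<in> polyfun I"
  using assms by (induction K rule: infinite_finite_induct) (auto intro: polyfun_const polyfun_mult)

lemma polyfun_prod_list:
  assumes "\<And>k. k \<in> set ks \<Longrightarrow> f k \<in> polyfun I"
  shows "(\<lambda>x. \<Prod>k\<leftarrow>ks. f k x) \<in> polyfun I"
  using assms by (induction ks) (auto intro: polyfun_const polyfun_mult)

section \<open>Functions determined by signs of polynomials\<close>

text \<open>For a predicate \<open>\<phi>\<close> this says that \<open>{x. \<phi> x}\<close> is semi-algebraic; for a general \<open>\<phi>\<close> it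
  says in addition that the range is finite.\<close>

definition sign_determined :: "'i set \<Rightarrow> (('i \<Rightarrow> real) \<Rightarrow> 'b) \<Rightarrow> bool" where
  "sign_determined I \<phi> \<longleftrightarrow>
     (\<exists>F. finite F \<and> F \<subseteq> polyfun I \<and> (\<forall>x y. (\<forall>f\<in>F. sgn (f x) = sgn (f y)) \<longrightarrow> \<phi> x = \<phi> y))"

section \<open>Closure properties of sign-determined functions\<close>

lemma sign_determined_const: "sign_determined I (\<lambda>x. c)"
  unfolding sign_determined_def by (rule exI[of _ "{}"]) auto

lemma sign_determined_sgn: "f \<in> polyfun I \<Longrightarrow> sign_determined I (\<lambda>x. sgn (f x))"
  unfolding sign_determined_def by (rule exI[of _ "{f}"]) auto

text \<open>Equal values have equal images, so \<open>h\<close> may be any function, even one built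
  with a choice operator. Operations on tables therefore never have to be expressed by
  formulas.\<close>

lemma sign_determined_compose: "sign_determined I \<phi> \<Longrightarrow> sign_determined I (\<lambda>x. h (\<phi> x))"
  unfolding sign_determined_def by metis

lemma sign_determined_compose2:
  assumes "sign_determined I \<phi>" "sign_determined I \<psi>"
  shows "sign_determined I (\<lambda>x. h (\<phi> x) (\<psi> x))"
proof -
  obtain F G where fin: "finite F" "F \<subseteq> polyfun I" "finite G" "G \<subseteq> polyfun I"
    and F: "\<And>x y. (\<forall>f\<in>F. sgn (f x) = sgn (f y)) \<Longrightarrow> \<phi> x = \<phi> y"
    and G: "\<And>x y. (\<forall>f\<in>G. sgn (f x) = sgn (f y)) \<Longrightarrow> \<psi> x = \<psi> y"
    using assms unfolding sign_determined_def by metis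
  show ?thesis
    unfolding sign_determined_def
  proof (intro exI[of _ "F \<union> G"] conjI allI impI)
    show "h (\<phi> x) (\<psi> x) = h (\<phi> y) (\<psi> y)" if "\<forall>f\<in>F \<union> G. sgn (f x) = sgn (f y)" for x y
      using F[of x y] G[of x y] that by simp
  qed (use fin in auto)
qed

lemma sign_determined_ball:
  assumes "finite K" "\<And>k. k \<in> K \<Longrightarrow> sign_determined I (P k)"
  shows "sign_determined I (\<lambda>x. \<forall>k\<in>K. P k x)"
  using assms
proof (induction K)
  case (insert k K)
  then have "sign_determined I (\<lambda>x. P k x \<and> (\<forall>k\<in>K. P k x))"
    by (intro sign_determined_compose2[where h = "(\<and>)"]) auto
  then show ?case by simp
qed (simp add: sign_determined_const)

text \<open>Packs finitely many values into one function. The fixed value outside \<open>K\<close>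
  is needed because equality of functions concerns all arguments.\<close>

lemma sign_determined_family:
  assumes "finite K" "\<And>k. k \<in> K \<Longrightarrow> sign_determined I (\<phi> k)"
  shows "sign_determined I (\<lambda>x k. if k \<in> K then \<phi> k x else c)"
  using assms
proof (induction K)
  case (insert k K)
  have "sign_determined I (\<lambda>x. (\<lambda>k. if k \<in> K then \<phi> k x else c)(k := \<phi> k x))"
    by (rule sign_determined_compose2[where h = "\<lambda>f v. f(k := v)"]) (use insert in auto)
  moreover have "(\<lambda>k. if k \<in> K then \<phi> k x else c)(k := \<phi> k x) =
      (\<lambda>j. if j \<in> insert k K then \<phi> j x else c)" for x
    by auto
  ultimately show ?case by simp
qed (simp add: sign_determined_const)

lemma sign_determined_if:
  assumes "sign_determined I P" "sign_determined I \<phi>" "sign_determined I \<psi>"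
  shows "sign_determined I (\<lambda>x. if P x then \<phi> x else \<psi> x)"
  using sign_determined_compose2[where h = "\<lambda>b (u, v). if b then u else v", OF assms(1)
      sign_determined_compose2[where h = Pair, OF assms(2,3)]]
  by simp

lemma sign_determined_eq_0: "f \<in> polyfun I \<Longrightarrow> sign_determined I (\<lambda>x. f x = 0)"
  using sign_determined_compose[OF sign_determined_sgn, where h = "\<lambda>s. s = 0"]
  by (simp add: sgn_zero_iff)

lemma sign_determined_ge_0: "f \<in> polyfun I \<Longrightarrow> sign_determined I (\<lambda>x. f x \<ge> 0)"
  using sign_determined_compose[OF sign_determined_sgn, where h = "\<lambda>s. s \<ge> 0"]
  by (simp add: zero_le_sgn_iff)

text \<open>The set is a union of sign cells of \<open>F\<close>. Each cell is given by equations
  and strict inequalities, and there are finitely many because a sign has three values.\<close>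

lemma sign_determined_imp_semialgebraic:
  assumes "sign_determined I P"
  shows "semialgebraic I {x \<in> coord_space I. P x}"
proof -
  obtain F where F: "finite F" "F \<subseteq> polyfun I"
    and P: "\<forall>x y. (\<forall>f\<in>F. sgn (f x) = sgn (f y)) \<longrightarrow> P x = P y"
    using assms unfolding sign_determined_def by (elim exE conjE)
  obtain rep where rep: "\<And>f. f \<in> polyfun I \<Longrightarrow> mpoly_vars (rep f) \<subseteq> I \<and> mpoly_eval (rep f) = f"
    
  proof -
    have "\<forall>f. \<exists>p. f \<in> polyfun I \<longrightarrow> mpoly_vars p \<subseteq> I \<and> mpoly_eval p = f"
      by (auto simp: polyfun_def)
    then show ?thesis using that by metis
  qed
  define cell where "cell v = {x \<in> coord_space I. \<forall>f\<in>F. sgn (f x) = v f}" for v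
  \<comment> \<open>The point realizing \<open>v\<close> may lie outside
    \<open>coord_space I\<close>: since \<open>P\<close> depends on signs only, any such point
    decides \<open>P\<close> on the whole cell.\<close>
  define V where "V = {v \<in> F \<rightarrow>\<^sub>E {-1, 0, 1 :: real}. \<exists>x. P x \<and> (\<forall>f\<in>F. sgn (f x) = v f)}"
  have "finite V"
    unfolding V_def using F(1) by (simp add: finite_PiE)
  have basic: "basic_semialgebraic I (cell v)" if "v \<in> V" for v
  proof -
    have v: "v f \<in> {-1, 0, 1}" if "f \<in> F" for f
      using \<open>v \<in> V\<close> that by (auto simp: V_def)
    define Z where "Z = rep ` {f \<in> F. v f = 0}"
    \<comment> \<open>Positive signs become strict inequalities below zero after negation.\<close>
    define N where "N = rep ` {f \<in> F. v f = -1} \<union> (\<lambda>f. rep (\<lambda>x. - f x)) ` {f \<in> F. v f = 1}"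
    have fin: "finite Z" "finite N" using F(1) by (auto simp: Z_def N_def)
    have vars: "mpoly_vars p \<subseteq> I" if "p \<in> Z \<union> N" for p
      using that F(2) rep polyfun_minus[of _ I] unfolding Z_def N_def by blast
    have ev: "mpoly_eval (rep f) = f" "mpoly_eval (rep (\<lambda>x. - f x)) = (\<lambda>x. - f x)" if "f \<in> F" for f
      using that F(2) rep polyfun_minus[of f I] by blast+
    have "(\<forall>f\<in>F. sgn (f x) = v f) \<longleftrightarrow> (\<forall>p\<in>Z. mpoly_eval p x = 0) \<and> (\<forall>p\<in>N. mpoly_eval p x < 0)" for x
    proof -
      have "sgn (f x) = v f \<longleftrightarrow> (v f = 0 \<longrightarrow> f x = 0) \<and> (v f = -1 \<longrightarrow> f x < 0) \<and> (v f = 1 \<longrightarrow> - f x < 0)"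
        if "f \<in> F" for f
        using v[OF that] by (auto simp: sgn_if)
      then show ?thesis
        unfolding Z_def N_def by (auto simp: ev ball_Un)
    qed
    then have "cell v = {x \<in> coord_space I. (\<forall>p\<in>Z. mpoly_eval p x = 0) \<and> (\<forall>p\<in>N. mpoly_eval p x < 0)}"
      by (auto simp: cell_def)
    with fin vars show ?thesis unfolding basic_semialgebraic_def by blast
  qed
  have "{x \<in> coord_space I. P x} = \<Union> (cell ` V)"
  proof (intro equalityI subsetI)
    fix x assume x: "x \<in> {x \<in> coord_space I. P x}"
    have "restrict (\<lambda>f. sgn (f x)) F \<in> V"
      using x by (auto simp: V_def sgn_if)
    moreover have "x \<in> cell (restrict (\<lambda>f. sgn (f x)) F)"
      using x by (auto simp: cell_def)
    ultimately show "x \<in> \<Union> (cell ` V)" by blast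
  next
    fix x assume "x \<in> \<Union> (cell ` V)"
    then obtain v where "v \<in> V" and x: "x \<in> coord_space I" "\<forall>f\<in>F. sgn (f x) = v f"
      by (auto simp: cell_def)
    then obtain y where "P y" "\<forall>f\<in>F. sgn (f y) = v f" by (auto simp: V_def)
    then have "P x" using P[rule_format, of x y] x(2) by simp
    with x(1) show "x \<in> {x \<in> coord_space I. P x}" by simp
  qed
  then show ?thesis
    unfolding semialgebraic_def using \<open>finite V\<close> basic by (intro exI[of _ "cell ` V"]) auto
qed

section \<open>Sign tables of real functions\<close>

text \<open>A change of sign would force a root by the intermediate value theorem.\<close>

lemma continuous_nonzero_sgn_eq:
  fixes f :: "real \<Rightarrow> real"
  assumes cont: "continuous_on UNIV f" and nz: "\<And>t. l < t \<Longrightarrow> t < r \<Longrightarrow> f t \<noteq> 0"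
    and u: "l < u" "u < r" and v: "l < v" "v < r"
  shows "sgn (f u) = sgn (f v)"
proof -
  have *: "sgn (f u) = sgn (f v)" if "l < u" "u \<le> v" "v < r" for u v
  proof (rule ccontr)
    assume ne: "sgn (f u) \<noteq> sgn (f v)"
    have "f u \<noteq> 0" "f v \<noteq> 0" using nz that by auto
    with ne consider "f u < 0" "f v > 0" | "f u > 0" "f v < 0"
      by (auto simp: sgn_if split: if_splits)
    then have "\<exists>t. u \<le> t \<and> t \<le> v \<and> f t = 0"
    proof cases
      case 1
      then show ?thesis
        using IVT'[of f u 0 v] that continuous_on_subset[OF cont] by auto
    next
      case 2
      then show ?thesis
        using IVT2'[of f v 0 u] that continuous_on_subset[OF cont] by auto
    qed
    then obtain t where "u \<le> t" "t \<le> v" "f t = 0" by blast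
    with nz[of t] that show False by simp
  qed
  show ?thesis
  proof (cases "u \<le> v")
    case True
    then show ?thesis using * u v by blast
  next
    case False
    then have "sgn (f v) = sgn (f u)" using u v by (intro *) auto
    then show ?thesis by (rule sym)
  qed
qed

lemma eventually_at_right_intervalI:
  fixes l :: real
  assumes "l < r" "\<And>u. l < u \<Longrightarrow> u < r \<Longrightarrow> P u"
  shows "\<forall>\<^sub>F u in at_right l. P u"
  using assms by (auto simp: eventually_at_right_field)

text \<open>Some point close to \<open>l\<close> has sign \<open>s\<close>, and the sign is constant
  on the root-free interval.\<close>

lemma sgn_eq_right_sgn:
  fixes f :: "real \<Rightarrow> real"
  assumes cont: "continuous_on UNIV f" and nz: "\<And>t. l < t \<Longrightarrow> t < r \<Longrightarrow> f t \<noteq> 0"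
    and ev: "\<forall>\<^sub>F u in at_right l. sgn (f u) = s" and u: "l < u" "u < r"
  shows "sgn (f u) = s"
proof -
  have "\<forall>\<^sub>F v in at_right l. l < v \<and> v < r"
    using u by (intro eventually_at_right_intervalI) auto
  then have "\<forall>\<^sub>F v in at_right l. l < v \<and> v < r \<and> sgn (f v) = s"
    using ev by eventually_elim blast
  then obtain v where v: "l < v" "v < r" "sgn (f v) = s"
    using eventually_happens[of _ "at_right l"] by (auto simp: trivial_limit_at_right_real)
  have "sgn (f u) = sgn (f v)"
    by (rule continuous_nonzero_sgn_eq[OF cont nz u v(1,2)])
  then show ?thesis using v(3) by (rule trans)
qed

text \<open>By the mean value theorem the difference is a positive multiple of a value of
  \<open>dq\<close> inside the interval, where \<open>dq\<close> has constant sign. The points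
  \<open>u\<close> and \<open>v\<close> may be end points, where \<open>dq\<close> may
  vanish.\<close>

lemma sgn_diff_eq_sgn_deriv:
  fixes q dq :: "real \<Rightarrow> real"
  assumes deriv: "\<And>t. (q has_real_derivative dq t) (at t)"
    and cont: "continuous_on UNIV dq"
    and nz: "\<And>t. l < t \<Longrightarrow> t < r \<Longrightarrow> dq t \<noteq> 0"
    and uv: "l \<le> u" "u < v" "v \<le> r" and w: "l < w" "w < r"
  shows "sgn (q v - q u) = sgn (dq w)"
proof -
  obtain z where z: "u < z" "z < v" "q v - q u = (v - u) * dq z"
    using MVT2[OF uv(2), of q dq] deriv by auto
  have "sgn (dq z) = sgn (dq w)"
    using z uv w by (intro continuous_nonzero_sgn_eq[OF cont nz]) auto
  with z uv show ?thesis by (simp add: sgn_mult)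
qed

text \<open>The change of sign yields a root and monotonicity makes it the only one. At the left end
  the sign just to the right of \<open>l\<close> is used, so a root at \<open>l\<close> needs no
  separate treatment.\<close>

lemma root_in_interval:
  fixes q dq :: "real \<Rightarrow> real"
  assumes deriv: "\<And>t. (q has_real_derivative dq t) (at t)"
    and cont: "continuous_on UNIV dq"
    and nz: "\<And>t. l < t \<Longrightarrow> t < r \<Longrightarrow> dq t \<noteq> 0" and "l < r"
    and ev: "\<forall>\<^sub>F u in at_right l. sgn (q u) = s" and neg: "s * sgn (q r) < 0"
  shows "\<exists>z. l < z \<and> z < r \<and> q z = 0 \<and> (\<forall>t. l < t \<longrightarrow> t < r \<longrightarrow> q t = 0 \<longrightarrow> t = z) \<and>
    (\<forall>u. z < u \<longrightarrow> u < r \<longrightarrow> sgn (q u) = sgn (dq u))"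
proof -
  have contq: "continuous_on A q" for A
    using deriv by (intro continuous_at_imp_continuous_on) (auto intro: DERIV_isCont)
  have "\<forall>\<^sub>F u in at_right l. l < u \<and> u < r"
    using \<open>l < r\<close> by (auto simp: eventually_at_right_field intro: exI[of _ r])
  then have "\<forall>\<^sub>F u in at_right l. l < u \<and> u < r \<and> sgn (q u) = s"
    using ev by eventually_elim auto
  then obtain u where u: "l < u" "u < r" "sgn (q u) = s"
    using eventually_happens[of _ "at_right l"] by (auto simp: trivial_limit_at_right_real)
  have "\<exists>z. u \<le> z \<and> z \<le> r \<and> q z = 0"
  proof (cases "q u > 0")
    case True
    then have "q r < 0" using neg u by (auto simp: sgn_if split: if_splits)
    then show ?thesis using IVT2'[of q r 0 u] True u contq by auto
  next
    case False
    then have "q u < 0" "q r > 0" using neg u by (auto simp: sgn_if split: if_splits)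
    then show ?thesis using IVT'[of q u 0 r] u contq by auto
  qed
  then obtain z where z: "u \<le> z" "z \<le> r" "q z = 0" by blast
  have "q r \<noteq> 0" using neg by auto
  with z have "z < r" by (cases "z = r") auto
  have mono: "sgn (q v - q u) = sgn (dq w)" if "l \<le> u" "u < v" "v \<le> r" "l < w" "w < r" for u v w
    by (rule sgn_diff_eq_sgn_deriv[OF deriv cont nz that])
  show ?thesis
  proof (intro exI conjI allI impI)
    show "l < z" "z < r" "q z = 0" using z u \<open>z < r\<close> by auto
    show "t = z" if "l < t" "t < r" "q t = 0" for t
      using mono[of t z t] mono[of z t t] that z u nz[of t] \<open>z < r\<close>
      by (cases t z rule: linorder_cases) (auto simp: sgn_zero_iff)
    show "sgn (q w) = sgn (dq w)" if "z < w" "w < r" for w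
      using mono[of z w w] that z u by simp
  qed
qed

text \<open>By monotonicity an inner root would give \<open>q\<close> the sign of \<open>dq\<close>
  at \<open>r\<close> and the opposite sign just to the right of \<open>l\<close>, which is the
  excluded change of sign.\<close>

lemma no_root_in_interval:
  fixes q dq :: "real \<Rightarrow> real"
  assumes deriv: "\<And>t. (q has_real_derivative dq t) (at t)"
    and cont: "continuous_on UNIV dq"
    and nz: "\<And>t. l < t \<Longrightarrow> t < r \<Longrightarrow> dq t \<noteq> 0"
    and ev: "\<forall>\<^sub>F u in at_right l. sgn (q u) = s" and nonneg: "\<not> s * sgn (q r) < 0"
    and t: "l < t" "t < r"
  shows "q t \<noteq> 0"
proof
  assume "q t = 0"
  have mono: "sgn (q v - q u) = sgn (dq t)" if "l \<le> u" "u < v" "v \<le> r" for u v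
    by (rule sgn_diff_eq_sgn_deriv[OF deriv cont nz that t])
  have r: "sgn (q r) = sgn (dq t)"
    using mono[of t r] t \<open>q t = 0\<close> by simp
  have "\<forall>\<^sub>F u in at_right l. sgn (q u) = - sgn (dq t)"
    using t(1)
  proof (rule eventually_at_right_intervalI)
    fix u assume u: "l < u" "u < t"
    then have "sgn (- q u) = sgn (dq t)"
      using mono[of u t] t \<open>q t = 0\<close> by simp
    then show "sgn (q u) = - sgn (dq t)" unfolding sgn_minus by linarith
  qed
  with ev have "\<forall>\<^sub>F u in at_right l. s = - sgn (dq t)"
    by (rule eventually_elim2) linarith
  then have "s = - sgn (dq t)"
    using eventually_happens by force
  then have "s * sgn (q r) = - (sgn (dq t) * sgn (dq t))" unfolding r by (simp only: mult_minus_left)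
  also have "\<dots> < 0" using nz[OF t] by (cases "dq t" "0::real" rule: linorder_cases) auto
  finally show False using nonneg by simp
qed

text \<open>The two components of an entry at \<open>t\<close> are the signs at \<open>t\<close> and immediately to the right of
  \<open>t\<close>. The first component of a table gives the signs near \<open>-\<infinity>\<close>. The points of a table need
  not all be roots.\<close>

type_synonym 'k sign_data = "('k \<Rightarrow> real) \<times> (('k \<Rightarrow> real) \<times> ('k \<Rightarrow> real)) list"

definition sign_entry ::
    "('k \<Rightarrow> real \<Rightarrow> real) \<Rightarrow> 'k set \<Rightarrow> real \<Rightarrow> ('k \<Rightarrow> real) \<times> ('k \<Rightarrow> real) \<Rightarrow> bool" where
  "sign_entry \<phi> F t e \<longleftrightarrow>
     (\<forall>f\<in>F. sgn (\<phi> f t) = fst e f \<and> (\<forall>\<^sub>F u in at_right t. sgn (\<phi> f u) = snd e f))"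

text \<open>Functions that vanish identically are exempt from the condition on roots, since finitely
  many points cannot list theirs.\<close>

definition sign_table ::
    "('k \<Rightarrow> real \<Rightarrow> real) \<Rightarrow> 'k set \<Rightarrow> real list \<Rightarrow> 'k sign_data \<Rightarrow> bool" where
  "sign_table \<phi> F xs T \<longleftrightarrow>
     sorted_wrt (<) xs \<and>
     (\<forall>f\<in>F. \<forall>t. \<phi> f t = 0 \<longrightarrow> t \<in> set xs \<or> (\<forall>s. \<phi> f s = 0)) \<and>
     (\<forall>f\<in>F. \<forall>\<^sub>F t in at_bot. sgn (\<phi> f t) = fst T f) \<and>
     list_all2 (sign_entry \<phi> F) xs (snd T)"

text \<open>\<open>\<tau>\<close> holds the signs on the interval left of the first entry. At \<open>+\<infinity>\<close> the sign of \<open>q\<close> is that of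
  its derivative \<open>dq\<close>.\<close>

primrec insert_roots ::
    "'k \<Rightarrow> 'k \<Rightarrow> ('k \<Rightarrow> real) \<Rightarrow> (('k \<Rightarrow> real) \<times> ('k \<Rightarrow> real)) list \<Rightarrow>
     (('k \<Rightarrow> real) \<times> ('k \<Rightarrow> real)) list" where
  "insert_roots q dq \<tau> [] = (if \<tau> q * \<tau> dq < 0 then [(\<tau>(q := 0), \<tau>(q := \<tau> dq))] else [])"
| "insert_roots q dq \<tau> (e # es) =
     (if \<tau> q * fst e q < 0 then [(\<tau>(q := 0), \<tau>(q := \<tau> dq))] else []) @ e # insert_roots q dq (snd e) es"

section \<open>Correctness of root insertion\<close>

text \<open>Every function other than \<open>q\<close> is identically zero or has no root between
  \<open>l\<close> and \<open>r\<close>, so it keeps its sign \<open>\<tau>\<close> at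
  \<open>z\<close> and beyond; to the right of \<open>z\<close> the sign of \<open>q\<close> is that
  of \<open>dq\<close>.\<close>

lemma sign_entry_new_root:
  assumes cont: "\<And>f. f \<in> F \<Longrightarrow> continuous_on UNIV (\<phi> f)"
    and nz: "\<And>f. f \<in> F \<Longrightarrow> f \<noteq> q \<Longrightarrow> (\<forall>s. \<phi> f s = 0) \<or> (\<forall>t. l < t \<longrightarrow> t < r \<longrightarrow> \<phi> f t \<noteq> 0)"
    and ev: "\<And>f. f \<in> F \<Longrightarrow> \<forall>\<^sub>F u in at_right l. sgn (\<phi> f u) = \<tau> f"
    and dq: "dq \<in> F" "\<And>t. l < t \<Longrightarrow> t < r \<Longrightarrow> \<phi> dq t \<noteq> 0"
    and z: "l < z" "z < r" "\<phi> q z = 0"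
    and right: "\<And>u. z < u \<Longrightarrow> u < r \<Longrightarrow> sgn (\<phi> q u) = sgn (\<phi> dq u)"
  shows "sign_entry \<phi> F z (\<tau>(q := 0), \<tau>(q := \<tau> dq))"
proof -
  have dq_sgn: "sgn (\<phi> dq u) = \<tau> dq" if "l < u" "u < r" for u
    by (rule sgn_eq_right_sgn[OF cont[OF dq(1)] dq(2) ev[OF dq(1)] that])
  have other: "sgn (\<phi> f u) = \<tau> f" if f: "f \<in> F" "f \<noteq> q" and u: "l < u" "u < r" for f u
    using nz[OF f]
  proof
    assume "\<forall>s. \<phi> f s = 0"
    then show ?thesis
      using ev[OF f(1)] by (simp add: trivial_limit_at_right_real)
  next
    assume "\<forall>t. l < t \<longrightarrow> t < r \<longrightarrow> \<phi> f t \<noteq> 0"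
    then show ?thesis
      using sgn_eq_right_sgn[OF cont[OF f(1)] _ ev[OF f(1)] u] by blast
  qed
  have "\<forall>\<^sub>F u in at_right z. sgn (\<phi> f u) = (\<tau>(q := \<tau> dq)) f" if "f \<in> F" for f
    using z(2)
  proof (rule eventually_at_right_intervalI)
    fix u assume "z < u" "u < r"
    then show "sgn (\<phi> f u) = (\<tau>(q := \<tau> dq)) f"
      using other[OF that] right dq_sgn[of u] z by auto
  qed
  then show ?thesis
    unfolding sign_entry_def using other z by auto
qed

text \<open>The intervals are treated from left to right, each by the existence or the absence of a
  root according to the signs at its ends. The induction lets \<open>l\<close> and
  \<open>\<tau>\<close> move on to the next listed point.\<close>

lemma insert_roots_correct:
  assumes deriv: "\<And>t. (\<phi> q has_real_derivative \<phi> dq t) (at t)"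
    and cont: "\<And>f. f \<in> F \<Longrightarrow> continuous_on UNIV (\<phi> f)"
    and F: "q \<in> F" "dq \<in> F" "dq \<noteq> q"
    and dq_nz: "\<exists>s. \<phi> dq s \<noteq> 0"
    and top: "\<forall>\<^sub>F t in at_top. sgn (\<phi> q t) = sgn (\<phi> dq t)"
  shows "sorted_wrt (<) (l # ys) \<Longrightarrow>
    (\<And>f t. f \<in> F \<Longrightarrow> f \<noteq> q \<Longrightarrow> l < t \<Longrightarrow> \<phi> f t = 0 \<Longrightarrow> t \<in> set ys \<or> (\<forall>s. \<phi> f s = 0)) \<Longrightarrow>
    (\<And>f. f \<in> F \<Longrightarrow> \<forall>\<^sub>F u in at_right l. sgn (\<phi> f u) = \<tau> f) \<Longrightarrow>
    list_all2 (sign_entry \<phi> F) ys es \<Longrightarrow>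
    \<exists>zs. sorted_wrt (<) (l # zs) \<and> set ys \<subseteq> set zs \<and> (\<forall>t>l. \<phi> q t = 0 \<longrightarrow> t \<in> set zs) \<and>
      list_all2 (sign_entry \<phi> F) zs (insert_roots q dq \<tau> es)"
proof (induction ys arbitrary: l \<tau> es)
  case Nil
  have nz: "\<phi> dq t \<noteq> 0" if "l < t" for t
    using Nil.prems(2)[OF F(2,3) that] dq_nz by auto
  obtain R where R: "\<And>t. t \<ge> R \<Longrightarrow> sgn (\<phi> q t) = sgn (\<phi> dq t)"
    using top by (auto simp: eventually_at_top_linorder)
  \<comment> \<open>Serves as right end of the last, unbounded interval: from \<open>r\<close> on,
    \<open>q\<close> has the nonzero sign of its derivative and hence no root.\<close>
  define r where "r = max R (l + 1)"
  have r: "l < r" "sgn (\<phi> q r) = sgn (\<phi> dq r)" using R[of r] by (auto simp: r_def)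
  have beyond: "\<phi> q t \<noteq> 0" if "r \<le> t" for t
    using R[of t] nz[of t] that r by (auto simp: r_def sgn_zero_iff)
  \<comment> \<open>Identifies the sign \<open>\<tau> dq\<close> tested by
    \<open>insert_roots\<close> with the sign of \<open>q\<close> at \<open>r\<close>. The bound
    \<open>r + 1\<close> makes \<open>r\<close> an interior point.\<close>
  have "sgn (\<phi> dq r) = \<tau> dq"
    by (rule sgn_eq_right_sgn[OF cont[OF F(2)] _ Nil.prems(3)[OF F(2)] r(1), of "r + 1"])
      (use nz in auto)
  with r have \<tau>dq: "\<tau> dq = sgn (\<phi> q r)" by simp
  have es: "es = []" using Nil.prems(4) by simp
  show ?case
  proof (cases "\<tau> q * sgn (\<phi> q r) < 0")
    case True
    obtain z where z: "l < z" "z < r" "\<phi> q z = 0" "\<And>t. l < t \<Longrightarrow> t < r \<Longrightarrow> \<phi> q t = 0 \<Longrightarrow> t = z"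
      "\<And>u. z < u \<Longrightarrow> u < r \<Longrightarrow> sgn (\<phi> q u) = sgn (\<phi> dq u)"
      using root_in_interval[OF deriv cont[OF F(2)] nz r(1) Nil.prems(3)[OF F(1)] True] by blast
    have other: "(\<forall>s. \<phi> f s = 0) \<or> (\<forall>t. l < t \<longrightarrow> t < r \<longrightarrow> \<phi> f t \<noteq> 0)"
      if "f \<in> F" "f \<noteq> q" for f
      using Nil.prems(2)[OF that] by auto
    have "sign_entry \<phi> F z (\<tau>(q := 0), \<tau>(q := \<tau> dq))"
      by (rule sign_entry_new_root[OF cont other Nil.prems(3) F(2) nz z(1-3,5)])
    moreover have "t = z" if "l < t" "\<phi> q t = 0" for t
      using z(4) beyond[of t] that by (cases "t < r") auto
    ultimately show ?thesis
      using True z(1) \<tau>dq es by (intro exI[of _ "[z]"]) auto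
  next
    case False
    have "\<phi> q t \<noteq> 0" if "l < t" for t
    proof (cases "t < r")
      case True
      then show ?thesis
        using no_root_in_interval[OF deriv cont[OF F(2)] nz Nil.prems(3)[OF F(1)] False that] by blast
    qed (use beyond in auto)
    then show ?thesis using False \<tau>dq es by (intro exI[of _ "[]"]) auto
  qed
next
  case (Cons r ys)
  obtain e es' where es: "es = e # es'" and e: "sign_entry \<phi> F r e"
    and es': "list_all2 (sign_entry \<phi> F) ys es'"
    using Cons.prems(4) by (auto simp: list_all2_Cons1)
  have lr: "l < r" and sorted: "sorted_wrt (<) (r # ys)" using Cons.prems(1) by auto
  have nz: "(\<forall>s. \<phi> f s = 0) \<or> (\<forall>t. l < t \<longrightarrow> t < r \<longrightarrow> \<phi> f t \<noteq> 0)" if "f \<in> F" "f \<noteq> q" for f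
    using Cons.prems(2)[OF that] Cons.prems(1) by fastforce
  have dq_nz': "\<phi> dq t \<noteq> 0" if "l < t" "t < r" for t
    using nz[OF F(2,3)] dq_nz that by auto
  have "\<exists>zs. sorted_wrt (<) (r # zs) \<and> set ys \<subseteq> set zs \<and> (\<forall>t>r. \<phi> q t = 0 \<longrightarrow> t \<in> set zs) \<and>
      list_all2 (sign_entry \<phi> F) zs (insert_roots q dq (snd e) es')"
  proof (rule Cons.IH[OF sorted _ _ es'])
    show "t \<in> set ys \<or> (\<forall>s. \<phi> f s = 0)" if "f \<in> F" "f \<noteq> q" "r < t" "\<phi> f t = 0" for f t
      using Cons.prems(2)[OF that(1,2) _ that(4)] that lr by auto
    show "\<forall>\<^sub>F u in at_right r. sgn (\<phi> f u) = snd e f" if "f \<in> F" for f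
      using e that by (auto simp: sign_entry_def)
  qed
  then obtain zs where zs: "sorted_wrt (<) (r # zs)" "set ys \<subseteq> set zs"
    "\<forall>t>r. \<phi> q t = 0 \<longrightarrow> t \<in> set zs"
    "list_all2 (sign_entry \<phi> F) zs (insert_roots q dq (snd e) es')"
    by blast
  have er: "fst e q = sgn (\<phi> q r)" using e F by (auto simp: sign_entry_def)
  show ?case
  proof (cases "\<tau> q * sgn (\<phi> q r) < 0")
    case True
    obtain z where z: "l < z" "z < r" "\<phi> q z = 0" "\<And>t. l < t \<Longrightarrow> t < r \<Longrightarrow> \<phi> q t = 0 \<Longrightarrow> t = z"
      "\<And>u. z < u \<Longrightarrow> u < r \<Longrightarrow> sgn (\<phi> q u) = sgn (\<phi> dq u)"
      using root_in_interval[OF deriv cont[OF F(2)] dq_nz' lr Cons.prems(3)[OF F(1)] True] by blast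
    have "sign_entry \<phi> F z (\<tau>(q := 0), \<tau>(q := \<tau> dq))"
      by (rule sign_entry_new_root[OF cont nz Cons.prems(3) F(2) dq_nz' z(1-3,5)])
    moreover have "t \<in> set (z # r # zs)" if "l < t" "\<phi> q t = 0" for t
      using z(4) zs(3) that by (cases t r rule: linorder_cases) auto
    ultimately show ?thesis
      using True z(1,2) er es e zs(1,2,4)
      by (intro exI[of _ "z # r # zs"]) auto
  next
    case False
    have "t \<in> set (r # zs)" if "l < t" "\<phi> q t = 0" for t
      using no_root_in_interval[OF deriv cont[OF F(2)] dq_nz' Cons.prems(3)[OF F(1)] False that(1)]
        zs(3) that by (cases t r rule: linorder_cases) auto
    then show ?thesis
      using False lr er es e zs(1,2,4) by (intro exI[of _ "r # zs"]) auto
  qed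
qed

section \<open>Univariate polynomials with polynomial coefficients\<close>

text \<open>Here \<open>d\<close> counts coefficients, so the formal degree is below
  \<open>d\<close> and only zero remains for \<open>d = 0\<close>. The true degree depends on
  \<open>x\<close>, as leading coefficients may vanish.\<close>

definition upoly :: "'i set \<Rightarrow> nat \<Rightarrow> (('i \<Rightarrow> real) \<Rightarrow> real \<Rightarrow> real) set" where
  "upoly I d = {\<lambda>x t. \<Sum>i<d. c i x * t ^ i | c. \<forall>i. c i \<in> polyfun I}"

lemma upoly_0: "upoly (I :: 'a set) 0 = {\<lambda>x t. 0}"
proof -
  have "\<exists>c :: nat \<Rightarrow> ('a \<Rightarrow> real) \<Rightarrow> real. \<forall>i. c i \<in> polyfun I"
    using polyfun_const by (intro exI[of _ "\<lambda>_ _. 0"]) auto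
  then show ?thesis by (auto simp: upoly_def)
qed

text \<open>Splitting off the formal leading term is what drives the inductions over
  \<open>d\<close>.\<close>

lemma upoly_Suc_iff:
  "f \<in> upoly I (Suc d) \<longleftrightarrow> (\<exists>g\<in>upoly I d. \<exists>a\<in>polyfun I. f = (\<lambda>x t. g x t + a x * t ^ d))"
proof
  assume "f \<in> upoly I (Suc d)"
  then obtain c where "\<forall>i. c i \<in> polyfun I" "f = (\<lambda>x t. \<Sum>i<Suc d. c i x * t ^ i)"
    by (auto simp: upoly_def)
  then show "\<exists>g\<in>upoly I d. \<exists>a\<in>polyfun I. f = (\<lambda>x t. g x t + a x * t ^ d)"
    by (intro bexI[of _ "\<lambda>x t. \<Sum>i<d. c i x * t ^ i"] bexI[of _ "c d"]) (auto simp: upoly_def)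
next
  assume "\<exists>g\<in>upoly I d. \<exists>a\<in>polyfun I. f = (\<lambda>x t. g x t + a x * t ^ d)"
  then obtain c a where c: "\<forall>i. c i \<in> polyfun I" "a \<in> polyfun I"
    "f = (\<lambda>x t. (\<Sum>i<d. c i x * t ^ i) + a x * t ^ d)"
    by (auto simp: upoly_def)
  then show "f \<in> upoly I (Suc d)"
    unfolding upoly_def mem_Collect_eq by (intro exI[of _ "c(d := a)"]) (auto simp: fun_eq_iff)
qed

lemma upoly_SucI:
  "g \<in> upoly I d \<Longrightarrow> a \<in> polyfun I \<Longrightarrow> (\<lambda>x t. g x t + a x * t ^ d) \<in> upoly I (Suc d)"
  by (auto simp: upoly_Suc_iff)

lemma upoly_SucE:
  assumes "f \<in> upoly I (Suc d)"
  obtains g a where "g \<in> upoly I d" "a \<in> polyfun I" "f = (\<lambda>x t. g x t + a x * t ^ d)"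
  using assms by (auto simp: upoly_Suc_iff)

lemma upoly_Suc_subset: "upoly I d \<subseteq> upoly I (Suc d)"
proof
  fix f assume "f \<in> upoly I d"
  from upoly_SucI[OF this polyfun_const[of 0]] show "f \<in> upoly I (Suc d)" by simp
qed

lemma upoly_mono: "d \<le> e \<Longrightarrow> upoly I d \<subseteq> upoly I e"
  using lift_Suc_mono_le[of "upoly I" d e] upoly_Suc_subset by blast

lemma upoly_scale: "f \<in> upoly I d \<Longrightarrow> a \<in> polyfun I \<Longrightarrow> (\<lambda>x t. a x * f x t) \<in> upoly I d"
proof (induction d arbitrary: f)
  case (Suc d)
  then obtain g b where g: "g \<in> upoly I d" "b \<in> polyfun I" "f = (\<lambda>x t. g x t + b x * t ^ d)"
    by (elim upoly_SucE)
  have "(\<lambda>x t. a x * g x t + (a x * b x) * t ^ d) \<in> upoly I (Suc d)"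
    by (rule upoly_SucI[OF Suc.IH[OF g(1) Suc.prems(2)] polyfun_mult[OF Suc.prems(2) g(2)]])
  then show ?case by (simp add: g(3) algebra_simps)
qed (simp add: upoly_0)

lemma upoly_add: "f \<in> upoly I d \<Longrightarrow> g \<in> upoly I d \<Longrightarrow> (\<lambda>x t. f x t + g x t) \<in> upoly I d"
proof (induction d arbitrary: f g)
  case (Suc d)
  obtain f' a where f: "f' \<in> upoly I d" "a \<in> polyfun I" "f = (\<lambda>x t. f' x t + a x * t ^ d)"
    using Suc.prems(1) by (elim upoly_SucE)
  obtain g' b where g: "g' \<in> upoly I d" "b \<in> polyfun I" "g = (\<lambda>x t. g' x t + b x * t ^ d)"
    using Suc.prems(2) by (elim upoly_SucE)
  have "(\<lambda>x t. (f' x t + g' x t) + (a x + b x) * t ^ d) \<in> upoly I (Suc d)"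
    by (rule upoly_SucI[OF Suc.IH[OF f(1) g(1)] polyfun_add[OF f(2) g(2)]])
  then show ?case by (simp add: f(3) g(3) algebra_simps)
qed (simp add: upoly_0)

lemma upoly_shift: "f \<in> upoly I d \<Longrightarrow> (\<lambda>x t. t ^ k * f x t) \<in> upoly I (d + k)"
proof (induction d arbitrary: f)
  case 0
  then show ?case using upoly_mono[of 0 k I] by (auto simp: upoly_0)
next
  case (Suc d)
  then obtain g a where g: "g \<in> upoly I d" "a \<in> polyfun I" "f = (\<lambda>x t. g x t + a x * t ^ d)"
    by (elim upoly_SucE)
  have "(\<lambda>x t. t ^ k * g x t + a x * t ^ (d + k)) \<in> upoly I (Suc (d + k))"
    by (rule upoly_SucI[OF Suc.IH[OF g(1)] g(2)])
  then show ?case by (simp add: g(3) algebra_simps power_add)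
qed

lemma has_real_derivative_add_monomial:
  assumes "(g has_real_derivative g') (at t)"
  shows "((\<lambda>t. g t + a * t ^ Suc d) has_real_derivative g' + (real (Suc d) * a) * t ^ d) (at t)"
proof -
  have "((\<lambda>t. g t + a * t ^ Suc d) has_real_derivative
      g' + a * (real (Suc d) * t ^ (Suc d - Suc 0))) (at t)"
    by (intro DERIV_add DERIV_cmult DERIV_pow assms)
  then show ?thesis by (simp add: mult_ac)
qed

text \<open>A single \<open>f'\<close> serves all parameters at once and loses one formal degree,
  also where the leading coefficient vanishes.\<close>

lemma upoly_deriv:
  "f \<in> upoly I (Suc d) \<Longrightarrow> \<exists>f'\<in>upoly I d. \<forall>x t. (f x has_real_derivative f' x t) (at t)"
proof (induction d arbitrary: f)
  case 0
  then obtain a where "f = (\<lambda>x t. a x)" by (auto simp: upoly_Suc_iff upoly_0)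
  then show ?case by (simp add: upoly_0)
next
  case (Suc d)
  obtain g a where g: "g \<in> upoly I (Suc d)" "a \<in> polyfun I" "f = (\<lambda>x t. g x t + a x * t ^ Suc d)"
    by (rule upoly_SucE[OF Suc.prems])
  obtain g' where g': "g' \<in> upoly I d" "\<And>x t. (g x has_real_derivative g' x t) (at t)"
    using Suc.IH[OF g(1)] by blast
  show ?case
  proof (intro bexI allI)
    show "(f x has_real_derivative g' x t + (real (Suc d) * a x) * t ^ d) (at t)" for x t
      unfolding g(3) by (rule has_real_derivative_add_monomial[OF g'(2)])
    show "(\<lambda>x t. g' x t + (real (Suc d) * a x) * t ^ d) \<in> upoly I (Suc d)"
      by (intro upoly_SucI g' polyfun_mult polyfun_const g)
  qed
qed

lemma upoly_continuous:
  assumes "f \<in> upoly I d"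
  shows "continuous_on UNIV (f x)"
proof -
  obtain c where "f = (\<lambda>x t. \<Sum>i<d. c i x * t ^ i)" using assms by (auto simp: upoly_def)
  then show ?thesis by (auto intro!: continuous_intros)
qed

section \<open>Behaviour at infinity\<close>

text \<open>After division by \<open>t ^ d\<close> each term is a constant times a positive power of
  the inverse of \<open>t\<close>.\<close>

lemma upoly_lower_order:
  assumes "f \<in> upoly I d"
  shows "((\<lambda>t. f x t / t ^ d) \<longlongrightarrow> 0) at_infinity"
proof -
  obtain c where c: "f = (\<lambda>x t. \<Sum>i<d. c i x * t ^ i)" using assms by (auto simp: upoly_def)
  have "((\<lambda>t. \<Sum>i<d. c i x * inverse t ^ (d - i)) \<longlongrightarrow> (\<Sum>i<d. c i x * 0 ^ (d - i))) at_infinity"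
    by (intro tendsto_intros tendsto_inverse_0)
  also have "(\<Sum>i<d. c i x * 0 ^ (d - i)) = 0"
    by (intro sum.neutral) auto
  finally show ?thesis
  proof (rule Lim_transform_eventually)
    show "\<forall>\<^sub>F t in at_infinity. (\<Sum>i<d. c i x * inverse t ^ (d - i)) = f x t / t ^ d"
      using eventually_not_equal_at_infinity[of 0]
    proof eventually_elim
      case (elim t)
      have "c i x * inverse t ^ (d - i) = c i x * t ^ i / t ^ d" if "i < d" for i
        using elim that by (simp add: field_simps power_add[symmetric])
      then show ?case by (simp add: c sum_divide_distrib)
    qed
  qed
qed

text \<open>Far out, \<open>g x t / t ^ d\<close> is smaller than \<open>a\<close> in absolute
  value, so the leading term decides the sign.\<close>

lemma upoly_eventually_sgn_lead:
  assumes "g \<in> upoly I d" "a \<noteq> 0"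
  shows "\<forall>\<^sub>F t in at_infinity. sgn (g x t + a * t ^ d) = sgn t ^ d * sgn a"
proof -
  have "\<forall>\<^sub>F t in at_infinity. \<bar>g x t / t ^ d\<bar> < \<bar>a\<bar>"
    using tendstoD[OF upoly_lower_order[OF assms(1)], of "\<bar>a\<bar>" x] assms(2) by (simp add: dist_real_def)
  then show ?thesis
    using eventually_not_equal_at_infinity[of 0]
  proof eventually_elim
    case (elim t)
    have "g x t + a * t ^ d = t ^ d * (g x t / t ^ d + a)"
      using elim by (simp add: field_simps)
    moreover have "sgn (g x t / t ^ d + a) = sgn a"
      using elim by (auto simp: sgn_if abs_if split: if_splits)
    moreover have "sgn (t ^ d) = sgn t ^ d"
      by (induction d) (auto simp: sgn_mult)
    ultimately show ?case by (simp add: sgn_mult)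
  qed
qed

lemma upoly_eventually_at_bot:
  assumes "g \<in> upoly I d" "a \<noteq> 0"
  shows "\<forall>\<^sub>F t in at_bot. sgn (g x t + a * t ^ d) = (-1) ^ d * sgn a"
proof -
  have "\<forall>\<^sub>F t in at_bot. sgn (g x t + a * t ^ d) = sgn t ^ d * sgn a"
    using filter_leD[OF at_bot_le_at_infinity upoly_eventually_sgn_lead[OF assms]] .
  then show ?thesis
    using eventually_gt_at_bot[of "0::real"] by eventually_elim simp
qed

lemma upoly_eventually_at_top:
  assumes "g \<in> upoly I d" "a \<noteq> 0"
  shows "\<forall>\<^sub>F t in at_top. sgn (g x t + a * t ^ d) = sgn a"
proof -
  have "\<forall>\<^sub>F t in at_top. sgn (g x t + a * t ^ d) = sgn t ^ d * sgn a"
    using filter_leD[OF at_top_le_at_infinity upoly_eventually_sgn_lead[OF assms]] .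
  then show ?thesis
    using eventually_gt_at_top[of "0::real"] by eventually_elim simp
qed

text \<open>The induction descends to the first coefficient that does not vanish at
  \<open>x\<close>. As a result, the sign near minus infinity tells whether a polynomial is
  identically zero.\<close>

lemma upoly_nonzero_eventually_at_bot:
  "f \<in> upoly I d \<Longrightarrow> f x t \<noteq> 0 \<Longrightarrow> \<exists>s. s \<noteq> 0 \<and> (\<forall>\<^sub>F t in at_bot. sgn (f x t) = s)"
proof (induction d arbitrary: f t)
  case (Suc d)
  then obtain g a where g: "g \<in> upoly I d" "f = (\<lambda>x t. g x t + a x * t ^ d)"
    by (elim upoly_SucE)
  show ?case
  proof (cases "a x = 0")
    case True
    then show ?thesis using Suc.IH[OF g(1)] Suc.prems(2) by (simp add: g(2))
  next
    case False
    then show ?thesis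
      using upoly_eventually_at_bot[OF g(1) False] g(2)
      by (intro exI[of _ "(-1) ^ d * sgn (a x)"]) (auto simp: sgn_zero_iff)
  qed
qed (auto simp: upoly_0)

section \<open>Remainders with parameters\<close>

text \<open>Only the sign at the roots of the divisor has to survive, so division by
  \<open>c\<close> is avoidable. Each step lowers the formal degree of \<open>p\<close> by one until
  it is below \<open>e\<close>.\<close>

lemma upoly_pseudo_remainder:
  assumes g: "g \<in> upoly I e" and c: "c \<in> polyfun I"
  shows "p \<in> upoly I d \<Longrightarrow>
    \<exists>r\<in>upoly I e. \<forall>x t. c x \<noteq> 0 \<longrightarrow> g x t + c x * t ^ e = 0 \<longrightarrow> sgn (r x t) = sgn (p x t)"
proof (induction d arbitrary: p)
  case 0
  then show ?case using upoly_mono[of 0 e I] by (intro bexI[of _ p]) auto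
next
  case (Suc d)
  show ?case
  proof (cases "Suc d \<le> e")
    case True
    then show ?thesis using Suc.prems upoly_mono[OF True, of I] by (intro bexI[of _ p]) auto
  next
    case False
    obtain p0 a where p: "p0 \<in> upoly I d" "a \<in> polyfun I" "p = (\<lambda>x t. p0 x t + a x * t ^ d)"
      using Suc.prems by (elim upoly_SucE)
    \<comment> \<open>Multiply by the square of \<open>c\<close>, which keeps the sign, and cancel the leading term.\<close>
    define p' where "p' = (\<lambda>x t. (c x * c x) * p0 x t + (- (c x * a x)) * (t ^ (d - e) * g x t))"
    have "(\<lambda>x t. t ^ (d - e) * g x t) \<in> upoly I d"
      using upoly_shift[OF g, of "d - e"] False by simp
    then have "p' \<in> upoly I d"
      unfolding p'_def by (intro upoly_add upoly_scale p polyfun_mult polyfun_minus c)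
    then obtain r where r: "r \<in> upoly I e"
      "\<And>x t. c x \<noteq> 0 \<Longrightarrow> g x t + c x * t ^ e = 0 \<Longrightarrow> sgn (r x t) = sgn (p' x t)"
      using Suc.IH[of p'] by blast
    have "sgn (p' x t) = sgn (p x t)" if "c x \<noteq> 0" "g x t + c x * t ^ e = 0" for x t
    proof -
      have gx: "g x t = - (c x * t ^ e)" using that(2) by simp
      have "t ^ d = t ^ (d - e) * t ^ e" using False by (simp add: power_add[symmetric])
      then have "p' x t = (c x * c x) * p x t"
        unfolding p'_def p(3) gx by (simp add: algebra_simps)
      moreover have "sgn (c x * c x) = 1" using that(1) by (simp add: sgn_mult sgn_if)
      ultimately show ?thesis by (simp add: sgn_mult)
    qed
    with r show ?thesis by metis
  qed
qed

text \<open>The true leading coefficient of \<open>g\<close> depends on the parameter, and so does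
  the remainder \<open>\<rho> x\<close>. It ranges over a finite set and is selected by which
  coefficients vanish.\<close>

lemma upoly_remainder:
  "g \<in> upoly I e \<Longrightarrow> p \<in> upoly I d \<Longrightarrow>
    \<exists>\<rho> R. sign_determined I \<rho> \<and> finite R \<and> R \<subseteq> upoly I (e - 1) \<and> range \<rho> \<subseteq> R \<and>
      (\<forall>x t. (\<exists>s. g x s \<noteq> 0) \<longrightarrow> g x t = 0 \<longrightarrow> sgn (\<rho> x x t) = sgn (p x t))"
proof (induction e arbitrary: g)
  case 0
  then show ?case
    by (intro exI[of _ "\<lambda>_ _ _. 0"] exI[of _ "{\<lambda>_ _. 0}"]) (auto simp: upoly_0 sign_determined_const)
next
  case (Suc e)
  obtain g0 c where g: "g0 \<in> upoly I e" "c \<in> polyfun I" "g = (\<lambda>x t. g0 x t + c x * t ^ e)"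
    using Suc.prems(1) by (elim upoly_SucE)
  obtain r where r: "r \<in> upoly I e"
    "\<And>x t. c x \<noteq> 0 \<Longrightarrow> g x t = 0 \<Longrightarrow> sgn (r x t) = sgn (p x t)"
    using upoly_pseudo_remainder[OF g(1,2) Suc.prems(2)] unfolding g(3) by blast
  obtain \<rho> R where \<rho>: "sign_determined I \<rho>" "finite R" "R \<subseteq> upoly I (e - 1)" "range \<rho> \<subseteq> R"
    "\<And>x t. (\<exists>s. g0 x s \<noteq> 0) \<Longrightarrow> g0 x t = 0 \<Longrightarrow> sgn (\<rho> x x t) = sgn (p x t)"
    using Suc.IH[OF g(1) Suc.prems(2)] by metis
  show ?case
  proof (intro exI[of _ "\<lambda>x. if c x = 0 then \<rho> x else r"] exI[of _ "insert r R"] conjI allI impI)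
    show "sign_determined I (\<lambda>x. if c x = 0 then \<rho> x else r)"
      by (intro sign_determined_if sign_determined_eq_0 sign_determined_const g \<rho>)
    show "finite (insert r R)" using \<rho>(2) by simp
    show "insert r R \<subseteq> upoly I (Suc e - 1)"
      using r(1) \<rho>(3) upoly_mono[of "e - 1" e I] by auto
    show "range (\<lambda>x. if c x = 0 then \<rho> x else r) \<subseteq> insert r R"
      using \<rho>(4) by (auto simp: image_subset_iff)
    show "sgn ((if c x = 0 then \<rho> x else r) x t) = sgn (p x t)"
      if "\<exists>s. g x s \<noteq> 0" "g x t = 0" for x t
    proof (cases "c x = 0")
      case True
      then show ?thesis using that \<rho>(5)[of x t] by (simp add: g(3))
    qed (use that r(2) in simp)
  qed
qed

section \<open>Sign tables of parametrised polynomials\<close>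

text \<open>Only the table must be determined by signs; the points \<open>xs\<close> may depend on
  the parameter in any way.\<close>

definition has_sign_tables :: "'i set \<Rightarrow> (('i \<Rightarrow> real) \<Rightarrow> real \<Rightarrow> real) set \<Rightarrow> bool" where
  "has_sign_tables I F \<longleftrightarrow>
     (\<exists>T. sign_determined I T \<and> (\<forall>x. \<exists>xs. sign_table (\<lambda>f. f x) F xs (T x)))"

text \<open>Everything is constant in \<open>t\<close>, so the table has no points: a polynomial
  with a root vanishes identically and is exempt.\<close>

lemma has_sign_tables_const:
  fixes F :: "(('i \<Rightarrow> real) \<Rightarrow> real \<Rightarrow> real) set"
  assumes "finite F" "F \<subseteq> upoly I (Suc 0)"
  shows "has_sign_tables I F"
proof -
  have const: "\<exists>a\<in>polyfun I. f = (\<lambda>x t. a x)" if "f \<in> F" for f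
    using that assms(2) by (auto simp: upoly_Suc_iff upoly_0 subset_iff)
  define T :: "('i \<Rightarrow> real) \<Rightarrow> (('i \<Rightarrow> real) \<Rightarrow> real \<Rightarrow> real) sign_data" where
    "T = (\<lambda>x. ((\<lambda>f. if f \<in> F then sgn (f x 0) else 0), []))"
  have "sign_determined I (\<lambda>x f. if f \<in> F then sgn (f x 0) else (0::real))"
    by (intro sign_determined_family sign_determined_sgn assms) (use const in fastforce)
  from sign_determined_compose[OF this] have "sign_determined I T"
    unfolding T_def by fast
  moreover have "sign_table (\<lambda>f. f x) F [] (T x)" for x
    using const by (fastforce simp: sign_table_def T_def)
  ultimately show ?thesis unfolding has_sign_tables_def by blast
qed

lemma list_all2_filter_iff:
  assumes "list_all2 P xs ys" "\<And>x y. P x y \<Longrightarrow> A x \<longleftrightarrow> B y"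
  shows "list_all2 (\<lambda>x y. P x y \<and> B y) (filter A xs) (filter B ys)"
  using assms(1) by (induction rule: list_all2_induct) (use assms(2) in auto)

text \<open>Extends sign data that cover a set \<open>H\<close> of polynomials, the derivative \<open>dq\<close> of \<open>q\<close> and the
  remainders \<open>r h\<close> of \<open>q\<close> modulo \<open>h \<in> H\<close> to \<open>q\<close>: at a root of \<open>h\<close> the sign of \<open>q\<close> is that
  of \<open>r h\<close>.\<close>

definition extend_entry ::
    "'k set \<Rightarrow> 'k \<Rightarrow> 'k \<Rightarrow> ('k \<Rightarrow> 'k) \<Rightarrow> ('k \<Rightarrow> real) \<times> ('k \<Rightarrow> real) \<Rightarrow> ('k \<Rightarrow> real) \<times> ('k \<Rightarrow> real)" where
  "extend_entry N q dq r e =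
     (let s = fst e (r (SOME h. h \<in> N \<and> fst e h = 0))
      in ((fst e)(q := s), (snd e)(q := if s \<noteq> 0 then s else snd e dq)))"

definition extend_table ::
    "'k set \<Rightarrow> 'k \<Rightarrow> 'k \<Rightarrow> ('k \<Rightarrow> 'k) \<Rightarrow> 'k sign_data \<Rightarrow> 'k sign_data" where
  "extend_table H q dq r T =
     (let N = {h \<in> H. fst T h \<noteq> 0}; \<tau> = (fst T)(q := - fst T dq)
      in (\<tau>, insert_roots q dq \<tau>
            (map (extend_entry N q dq r) (filter (\<lambda>e. \<exists>h\<in>N. fst e h = 0) (snd T)))))"

section \<open>Extending a table by one polynomial\<close>

lemma eventually_at_right_sgn_continuous:
  fixes f :: "real \<Rightarrow> real"
  assumes "continuous_on UNIV f" "f t \<noteq> 0"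
  shows "\<forall>\<^sub>F u in at_right t. sgn (f u) = sgn (f t)"
proof -
  have lim: "(f \<longlongrightarrow> f t) (at_right t)"
    using assms(1) by (auto simp: continuous_on_def intro: tendsto_within_subset)
  show ?thesis
  proof (cases "f t > 0")
    case True
    then show ?thesis using order_tendstoD(1)[OF lim, of 0] by (auto elim: eventually_mono)
  next
    case False
    then have "f t < 0" using assms(2) by simp
    then show ?thesis using order_tendstoD(2)[OF lim, of 0] by (auto elim: eventually_mono)
  qed
qed

lemma finite_gap_right:
  fixes t :: real
  assumes "finite S"
  obtains r where "t < r" "\<And>u. t < u \<Longrightarrow> u < r \<Longrightarrow> u \<notin> S"
proof
  \<comment> \<open>The point \<open>t + 1\<close> keeps the set nonempty when no element of
    \<open>S\<close> exceeds \<open>t\<close>.\<close>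
  let ?r = "Min (insert (t + 1) {u \<in> S. t < u})"
  show "t < ?r" using assms by (subst Min_gr_iff) auto
  show "u \<notin> S" if "t < u" "u < ?r" for u
    using that assms by (subst (asm) Min_gr_iff) auto
qed

text \<open>On a gap without zeros of \<open>dq\<close> the function \<open>q\<close> is monotone,
  and it starts from the value zero.\<close>

lemma eventually_at_right_sgn_deriv:
  fixes q dq :: "real \<Rightarrow> real"
  assumes deriv: "\<And>t. (q has_real_derivative dq t) (at t)"
    and cont: "continuous_on UNIV dq"
    and S: "finite S" "\<And>t. dq t = 0 \<Longrightarrow> t \<in> S" and "q t = 0"
  shows "\<forall>\<^sub>F u in at_right t. sgn (q u) = sgn (dq u)"
proof -
  obtain r where r: "t < r" "\<And>u. t < u \<Longrightarrow> u < r \<Longrightarrow> u \<notin> S"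
    using finite_gap_right[OF S(1), of t] by blast
  from r(1) show ?thesis
  proof (rule eventually_at_right_intervalI)
    fix u assume u: "t < u" "u < r"
    have "sgn (q u - q t) = sgn (dq u)"
      by (rule sgn_diff_eq_sgn_deriv[OF deriv cont, of t r]) (use r S u in auto)
    then show "sgn (q u) = sgn (dq u)" using \<open>q t = 0\<close> by simp
  qed
qed

text \<open>Treats one parameter value at which \<open>q\<close> has positive true degree;
  \<open>dq_nz\<close>, \<open>top\<close> and \<open>bot\<close> express this. Remainders give the
  sign of \<open>q\<close> at the roots of \<open>H\<close>, and the other roots of \<open>q\<close>
  are inserted between them.\<close>

lemma sign_table_extend:
  fixes \<phi> :: "'k \<Rightarrow> real \<Rightarrow> real"
  assumes tab: "sign_table \<phi> G xs T"
    and G: "H \<subseteq> G" "r ` H \<subseteq> G" "finite H" and dq: "dq \<in> H" "dq \<noteq> q"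
    and cont: "\<And>f. f \<in> insert q H \<Longrightarrow> continuous_on UNIV (\<phi> f)"
    and deriv: "\<And>t. (\<phi> q has_real_derivative \<phi> dq t) (at t)"
    and rem: "\<And>h t. h \<in> H \<Longrightarrow> \<exists>s. \<phi> h s \<noteq> 0 \<Longrightarrow> \<phi> h t = 0 \<Longrightarrow> sgn (\<phi> (r h) t) = sgn (\<phi> q t)"
    and nonzero: "\<And>h t. h \<in> H \<Longrightarrow> \<phi> h t \<noteq> 0 \<Longrightarrow> \<exists>s. s \<noteq> 0 \<and> (\<forall>\<^sub>F t in at_bot. sgn (\<phi> h t) = s)"
    and dq_nz: "\<exists>s. \<phi> dq s \<noteq> 0"
    and top: "\<forall>\<^sub>F t in at_top. sgn (\<phi> q t) = sgn (\<phi> dq t)"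
    and bot: "\<forall>\<^sub>F t in at_bot. sgn (\<phi> q t) = - sgn (\<phi> dq t)"
  shows "\<exists>zs. sign_table \<phi> (insert q H) zs (extend_table H q dq r T)"
proof -
  \<comment> \<open>The members of \<open>H\<close> that are not identically zero, recognized by
    their sign near minus infinity.\<close>
  define N where "N = {h \<in> H. fst T h \<noteq> 0}"
  define \<tau> where "\<tau> = (fst T)(q := - fst T dq)"
  \<comment> \<open>Points at which no member of \<open>N\<close> vanishes are dropped, since no
    remainder gives the sign of \<open>q\<close> there.\<close>
  define ys where "ys = filter (\<lambda>t. \<exists>h\<in>N. \<phi> h t = 0) xs"
  define es where "es = map (extend_entry N q dq r) (filter (\<lambda>e. \<exists>h\<in>N. fst e h = 0) (snd T))"
  have sorted: "sorted_wrt (<) xs"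
    and roots: "\<And>f t. f \<in> G \<Longrightarrow> \<phi> f t = 0 \<Longrightarrow> t \<in> set xs \<or> (\<forall>s. \<phi> f s = 0)"
    and at_bot: "\<And>f. f \<in> G \<Longrightarrow> \<forall>\<^sub>F t in at_bot. sgn (\<phi> f t) = fst T f"
    and entries: "list_all2 (sign_entry \<phi> G) xs (snd T)"
    using tab unfolding sign_table_def by blast+
  have N_iff: "h \<in> N \<longleftrightarrow> (\<exists>s. \<phi> h s \<noteq> 0)" if h: "h \<in> H" for h
  proof
    assume "h \<in> N"
    show "\<exists>s. \<phi> h s \<noteq> 0"
    proof (rule ccontr)
      assume "\<nexists>s. \<phi> h s \<noteq> 0"
      then have "\<forall>\<^sub>F t in at_bot :: real filter. 0 = fst T h"
        using at_bot[of h] G h by auto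
      then show False using \<open>h \<in> N\<close> by (simp add: N_def)
    qed
  next
    assume "\<exists>s. \<phi> h s \<noteq> 0"
    then obtain s where s: "s \<noteq> 0" "\<forall>\<^sub>F t in at_bot. sgn (\<phi> h t) = s"
      using nonzero[OF h] by blast
    have "\<forall>\<^sub>F t in at_bot. sgn (\<phi> h t) = fst T h" using at_bot G h by blast
    with s(2) have "\<forall>\<^sub>F t in at_bot :: real filter. s = fst T h" by eventually_elim simp
    then show "h \<in> N" using s h by (simp add: N_def)
  qed
  have "dq \<in> N" using N_iff[OF dq(1)] dq_nz by simp
  \<comment> \<open>No root of a member of \<open>N\<close> is dropped, so between the points of
    \<open>ys\<close> every member of \<open>H\<close> is identically zero or has no root.\<close>
  have set_ys: "t \<in> set ys" if "h \<in> N" "\<phi> h t = 0" for h t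
    using roots[of h t] N_iff[of h] that G by (auto simp: ys_def N_def)
  have "list_all2 (\<lambda>t e. sign_entry \<phi> G t e \<and> (\<exists>h\<in>N. fst e h = 0)) ys
      (filter (\<lambda>e. \<exists>h\<in>N. fst e h = 0) (snd T))"
    unfolding ys_def
  proof (rule list_all2_filter_iff[OF entries])
    fix t e assume "sign_entry \<phi> G t e"
    then have "fst e h = sgn (\<phi> h t)" if "h \<in> N" for h
      using that G by (auto simp: sign_entry_def N_def)
    then show "(\<exists>h\<in>N. \<phi> h t = 0) = (\<exists>h\<in>N. fst e h = 0)" by (auto simp: sgn_zero_iff)
  qed
  moreover have "sign_entry \<phi> (insert q H) t (extend_entry N q dq r e)"
    if e: "sign_entry \<phi> G t e" "\<exists>h\<in>N. fst e h = 0" for t e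
  proof -
    \<comment> \<open>Any member of \<open>N\<close> that vanishes at \<open>t\<close> serves, as
      its remainder has the sign of \<open>q\<close> there.\<close>
    define h where "h = (SOME h. h \<in> N \<and> fst e h = 0)"
    have h: "h \<in> N" "fst e h = 0"
      using someI_ex[of "\<lambda>h. h \<in> N \<and> fst e h = 0"] e(2) by (auto simp: h_def)
    then have "h \<in> H" by (simp add: N_def)
    have val: "sgn (\<phi> f t) = fst e f" "\<forall>\<^sub>F u in at_right t. sgn (\<phi> f u) = snd e f" if "f \<in> G" for f
      using e(1) that by (auto simp: sign_entry_def)
    have "sgn (\<phi> h t) = 0" using val(1)[of h] h \<open>h \<in> H\<close> G by auto
    then have "\<phi> h t = 0" by (simp add: sgn_zero_iff)
    then have "sgn (\<phi> q t) = sgn (\<phi> (r h) t)"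
      using rem[OF \<open>h \<in> H\<close>] N_iff[OF \<open>h \<in> H\<close>] h by simp
    also have "\<dots> = fst e (r h)" using val(1) \<open>h \<in> H\<close> G by blast
    finally have q: "fst e (r h) = sgn (\<phi> q t)" by simp
    have "\<forall>\<^sub>F u in at_right t. sgn (\<phi> q u) = (if \<phi> q t \<noteq> 0 then sgn (\<phi> q t) else snd e dq)"
    proof (cases "\<phi> q t = 0")
      case True
      have "\<forall>\<^sub>F u in at_right t. sgn (\<phi> q u) = sgn (\<phi> dq u)"
        by (rule eventually_at_right_sgn_deriv[OF deriv _ _ _ True, where S = "set ys"])
          (use cont dq set_ys[OF \<open>dq \<in> N\<close>] in auto)
      moreover have "\<forall>\<^sub>F u in at_right t. sgn (\<phi> dq u) = snd e dq"
        using val(2) dq G by blast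
      ultimately have "\<forall>\<^sub>F u in at_right t. sgn (\<phi> q u) = snd e dq" by eventually_elim simp
      then show ?thesis using True by simp
    qed (use eventually_at_right_sgn_continuous[OF cont] in auto)
    moreover have "extend_entry N q dq r e =
        ((fst e)(q := sgn (\<phi> q t)), (snd e)(q := if \<phi> q t \<noteq> 0 then sgn (\<phi> q t) else snd e dq))"
      by (simp add: extend_entry_def Let_def h_def[symmetric] q sgn_zero_iff)
    ultimately show ?thesis
      unfolding sign_entry_def using val G by auto
  qed
  ultimately have es: "list_all2 (sign_entry \<phi> (insert q H)) ys es"
    unfolding es_def list_all2_map2 by (rule list_all2_mono) auto
  have \<tau>: "\<forall>\<^sub>F t in at_bot. sgn (\<phi> f t) = \<tau> f" if "f \<in> insert q H" for f
  proof (cases "f = q")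
    case True
    have "\<forall>\<^sub>F t in at_bot. sgn (\<phi> dq t) = fst T dq" using at_bot dq G by auto
    with bot have "\<forall>\<^sub>F t in at_bot. sgn (\<phi> q t) = - fst T dq" by eventually_elim simp
    then show ?thesis by (simp add: True \<tau>_def)
  next
    case False
    then show ?thesis using at_bot[of f] that G by (auto simp: \<tau>_def)
  qed
  have "\<forall>\<^sub>F t in at_bot. (\<forall>f\<in>insert q H. sgn (\<phi> f t) = \<tau> f) \<and> (\<forall>y\<in>set ys. t < y)"
    using G(3) \<tau> by (intro eventually_conj eventually_ball_finite) (auto intro: eventually_gt_at_bot)
  then obtain b where b: "\<And>t f. t \<le> b \<Longrightarrow> f \<in> insert q H \<Longrightarrow> sgn (\<phi> f t) = \<tau> f"
    "\<And>t y. t \<le> b \<Longrightarrow> y \<in> set ys \<Longrightarrow> t < y"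
    by (auto simp: eventually_at_bot_linorder)
  \<comment> \<open>Strictly below \<open>b\<close>, so that the signs \<open>\<tau>\<close> also
    hold just to the right of \<open>l\<close>.\<close>
  define l where "l = b - 1"
  have "\<exists>zs. sorted_wrt (<) (l # zs) \<and> set ys \<subseteq> set zs \<and> (\<forall>t>l. \<phi> q t = 0 \<longrightarrow> t \<in> set zs) \<and>
      list_all2 (sign_entry \<phi> (insert q H)) zs (insert_roots q dq \<tau> es)"
  proof (rule insert_roots_correct[OF deriv cont _ _ dq(2) dq_nz top _ _ _ es])
    show "sorted_wrt (<) (l # ys)"
      using sorted b(2)[of l] by (auto simp: ys_def l_def sorted_wrt_filter)
    show "t \<in> set ys \<or> (\<forall>s. \<phi> f s = 0)" if "f \<in> insert q H" "f \<noteq> q" "\<phi> f t = 0" for f t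
      using that set_ys[of f t] N_iff[of f] by auto
    show "\<forall>\<^sub>F u in at_right l. sgn (\<phi> f u) = \<tau> f" if "f \<in> insert q H" for f
      by (rule eventually_at_right_intervalI[of l b]) (use b(1) that in \<open>auto simp: l_def\<close>)
  qed (use dq in auto)
  then obtain zs where zs: "sorted_wrt (<) (l # zs)" "set ys \<subseteq> set zs"
    "\<And>t. t > l \<Longrightarrow> \<phi> q t = 0 \<Longrightarrow> t \<in> set zs"
    "list_all2 (sign_entry \<phi> (insert q H)) zs (insert_roots q dq \<tau> es)"
    by blast
  \<comment> \<open>Up to \<open>l\<close> the sign of \<open>q\<close> is the negative of this
    nonzero sign, so all roots of \<open>q\<close> lie to the right of \<open>l\<close>.\<close>
  have "fst T dq \<noteq> 0" using \<open>dq \<in> N\<close> by (simp add: N_def)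
  then have "\<phi> q t \<noteq> 0" if "t \<le> l" for t
    using b(1)[of t q] that by (auto simp: l_def \<tau>_def)
  then have q_roots: "t \<in> set zs" if "\<phi> q t = 0" for t
    using zs(3)[of t] that by force
  have "t \<in> set zs \<or> (\<forall>s. \<phi> f s = 0)" if "f \<in> insert q H" "\<phi> f t = 0" for f t
    using that q_roots zs(2) set_ys[of f t] N_iff[of f] by auto
  moreover have "extend_table H q dq r T = (\<tau>, insert_roots q dq \<tau> es)"
    by (simp add: extend_table_def N_def \<tau>_def es_def Let_def)
  ultimately have "sign_table \<phi> (insert q H) zs (extend_table H q dq r T)"
    using zs(1,4) \<tau> by (auto simp: sign_table_def)
  then show ?thesis ..
qed

lemma sign_table_subset:
  assumes "sign_table \<phi> G xs T" "F \<subseteq> G"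
  shows "sign_table \<phi> F xs T"
proof -
  have "sign_entry \<phi> F t e" if "sign_entry \<phi> G t e" for t e
    using that assms(2) unfolding sign_entry_def by blast
  then have "list_all2 (sign_entry \<phi> F) xs (snd T)"
    using assms(1) list_all2_mono unfolding sign_table_def by blast
  then show ?thesis using assms unfolding sign_table_def by blast
qed

section \<open>Existence of tables by induction on the degree\<close>

text \<open>Trades \<open>q\<close> for its derivative, its part \<open>g\<close> without the
  leading term, and its remainders, all of lower formal degree. Where the leading coefficient
  vanishes, \<open>q\<close> coincides with \<open>g\<close>; elsewhere the table is
  extended.\<close>

lemma has_sign_tables_insert:
  fixes F :: "(('i \<Rightarrow> real) \<Rightarrow> real \<Rightarrow> real) set"
  assumes F: "finite F" "F \<subseteq> upoly I (Suc (Suc d))" and q: "q \<in> upoly I (Suc (Suc d))"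
    and IH: "\<And>G. finite G \<Longrightarrow> G \<subseteq> upoly I (Suc d) \<Longrightarrow> has_sign_tables I (F \<union> G)"
  shows "has_sign_tables I (insert q F)"
proof -
  obtain g a where g: "g \<in> upoly I (Suc d)" "a \<in> polyfun I" "q = (\<lambda>x t. g x t + a x * t ^ Suc d)"
    using q by (rule upoly_SucE)
  obtain g' where g': "g' \<in> upoly I d" "\<And>x t. (g x has_real_derivative g' x t) (at t)"
    using upoly_deriv[OF g(1)] by blast
  define dq where "dq = (\<lambda>x t. g' x t + (real (Suc d) * a x) * t ^ d)"
  have dq: "dq \<in> upoly I (Suc d)"
    unfolding dq_def by (intro upoly_SucI g' polyfun_mult polyfun_const g)
  have deriv: "(q x has_real_derivative dq x t) (at t)" for x t
    unfolding g(3) dq_def by (rule has_real_derivative_add_monomial[OF g'(2)])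
  define H where "H = insert dq F"
  have H: "finite H" "H \<subseteq> upoly I (Suc (Suc d))"
    using F dq upoly_Suc_subset[of I "Suc d"] by (auto simp: H_def)
  let ?rem = "\<lambda>h \<rho> R. sign_determined I \<rho> \<and> finite R \<and> R \<subseteq> upoly I (Suc d) \<and> range \<rho> \<subseteq> R \<and>
      (\<forall>x t. (\<exists>s. h x s \<noteq> 0) \<longrightarrow> h x t = 0 \<longrightarrow> sgn (\<rho> x x t) = sgn (q x t))"
  have "\<forall>h\<in>H. \<exists>\<rho> R. ?rem h \<rho> R"
  proof
    fix h assume "h \<in> H"
    then have "h \<in> upoly I (Suc (Suc d))" using H(2) by blast
    from upoly_remainder[OF this q] show "\<exists>\<rho> R. ?rem h \<rho> R" by simp
  qed
  from bchoice[OF this] obtain \<rho> where "\<forall>h\<in>H. \<exists>R. ?rem h (\<rho> h) R" by (rule exE)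
  from bchoice[OF this] obtain R where "\<forall>h\<in>H. ?rem h (\<rho> h) (R h)" by (rule exE)
  then have \<rho>: "\<And>h. h \<in> H \<Longrightarrow> sign_determined I (\<rho> h)"
    and R: "\<And>h. h \<in> H \<Longrightarrow> finite (R h)" "\<And>h. h \<in> H \<Longrightarrow> R h \<subseteq> upoly I (Suc d)"
      "\<And>h. h \<in> H \<Longrightarrow> range (\<rho> h) \<subseteq> R h"
    and rem: "\<And>h x t. h \<in> H \<Longrightarrow> \<exists>s. h x s \<noteq> 0 \<Longrightarrow> h x t = 0 \<Longrightarrow> sgn (\<rho> h x x t) = sgn (q x t)"
    by blast+
  \<comment> \<open>Contains every candidate remainder, because the one in use varies with the
    parameter.\<close>
  define G where "G = F \<union> ({dq, g} \<union> (\<Union>h\<in>H. R h))"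
  have "has_sign_tables I G"
    unfolding G_def using H(1) R(1,2) dq g(1) by (intro IH) auto
  then obtain T where T: "sign_determined I T" "\<And>x. \<exists>xs. sign_table (\<lambda>f. f x) G xs (T x)"
    by (auto simp: has_sign_tables_def)
  \<comment> \<open>Outside \<open>H\<close> the value \<open>q\<close> is a mere default that makes
    the whole function \<open>r x\<close> sign determined.\<close>
  define r where "r = (\<lambda>x h. if h \<in> H then \<rho> h x else q)"
  \<comment> \<open>Copies the signs of \<open>g\<close> to \<open>q\<close>, for vanishing leading
    coefficient.\<close>
  define sub :: "(('i \<Rightarrow> real) \<Rightarrow> real \<Rightarrow> real) sign_data \<Rightarrow> _ sign_data" where
    "sub = (\<lambda>T. ((fst T)(q := fst T g),
      map (\<lambda>e. ((fst e)(q := fst e g), (snd e)(q := snd e g))) (snd T)))"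
  define T' where "T' = (\<lambda>x. if a x = 0 then sub (T x) else extend_table H q dq (r x) (T x))"
  have "sign_determined I r"
    unfolding r_def by (intro sign_determined_family H \<rho>)
  then have "sign_determined I T'"
    unfolding T'_def
    by (intro sign_determined_if sign_determined_eq_0 g sign_determined_compose[OF T(1), where h = sub]
        sign_determined_compose2[OF _ T(1), where h = "extend_table H q dq"])
  moreover have "\<exists>zs. sign_table (\<lambda>f. f x) (insert q F) zs (T' x)" for x
  proof -
    obtain xs where xs: "sign_table (\<lambda>f. f x) G xs (T x)" using T(2) by blast
    show ?thesis
    proof (cases "a x = 0")
      case True
      then have q_eq: "q x = g x" by (simp add: g(3) fun_eq_iff)
      have "g \<in> G" "F \<subseteq> G" by (auto simp: G_def)
      then have "sign_table (\<lambda>f. f x) (insert q F) xs (sub (T x))"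
        using xs
        by (auto simp: sign_table_def sub_def q_eq list_all2_map2 sign_entry_def elim!: list_all2_mono)
      then show ?thesis using True by (auto simp: T'_def)
    next
      case False
      have lead: "real (Suc d) * a x \<noteq> 0" "sgn (real (Suc d) * a x) = sgn (a x)"
        using False by (auto simp: sgn_mult)
      have "\<forall>\<^sub>F t in at_top. sgn (q x t) = sgn (a x)"
        using upoly_eventually_at_top[OF g(1) False] unfolding g(3) .
      moreover have "\<forall>\<^sub>F t in at_top. sgn (dq x t) = sgn (a x)"
        using upoly_eventually_at_top[OF g'(1) lead(1)] unfolding dq_def lead(2) .
      ultimately have top: "\<forall>\<^sub>F t in at_top. sgn (q x t) = sgn (dq x t)"
        by eventually_elim simp
      have bot_q: "\<forall>\<^sub>F t in at_bot. sgn (q x t) = (-1) ^ Suc d * sgn (a x)"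
        using upoly_eventually_at_bot[OF g(1) False] unfolding g(3) .
      have bot_dq: "\<forall>\<^sub>F t in at_bot. sgn (dq x t) = (-1) ^ d * sgn (a x)"
        using upoly_eventually_at_bot[OF g'(1) lead(1)] unfolding dq_def lead(2) .
      have bot: "\<forall>\<^sub>F t in at_bot. sgn (q x t) = - sgn (dq x t) \<and> dq x t \<noteq> 0"
        using bot_q bot_dq by eventually_elim (use False in \<open>auto simp: sgn_zero_iff\<close>)
      \<comment> \<open>Opposite nonzero signs at one point show that \<open>dq\<close> and
        \<open>q\<close> are different keys of the table.\<close>
      then obtain s where s: "sgn (q x s) = - sgn (dq x s)" "dq x s \<noteq> 0"
        using eventually_happens[OF bot] by auto
      then have "dq \<noteq> q" by (auto simp: sgn_if split: if_splits)
      have ext: "\<exists>zs. sign_table (\<lambda>f. f x) (insert q H) zs (extend_table H q dq (r x) (T x))"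
      proof (rule sign_table_extend[OF xs])
        show "H \<subseteq> G" "r x ` H \<subseteq> G" "dq \<in> H"
          using R(3) by (auto simp: G_def H_def r_def)
        show "continuous_on UNIV (f x)" if "f \<in> insert q H" for f
          using that H q upoly_continuous by blast
        show "sgn (r x h x t) = sgn (q x t)" if "h \<in> H" "\<exists>s. h x s \<noteq> 0" "h x t = 0" for h t
          using rem[OF that] that(1) by (simp add: r_def)
        show "\<exists>s. s \<noteq> 0 \<and> (\<forall>\<^sub>F t in at_bot. sgn (h x t) = s)" if "h \<in> H" "h x t \<noteq> 0" for h t
          using upoly_nonzero_eventually_at_bot that H(2) by blast
        show "\<forall>\<^sub>F t in at_bot. sgn (q x t) = - sgn (dq x t)"
          using bot by eventually_elim simp
      qed (use H \<open>dq \<noteq> q\<close> deriv s top in auto)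
      have "insert q F \<subseteq> insert q H" by (auto simp: H_def)
      with ext have "\<exists>zs. sign_table (\<lambda>f. f x) (insert q F) zs (extend_table H q dq (r x) (T x))"
        using sign_table_subset by blast
      then show ?thesis using False by (simp add: T'_def)
    qed
  qed
  ultimately show ?thesis unfolding has_sign_tables_def by blast
qed

text \<open>Inside the induction on the degree runs one on the number of polynomials of top degree.
  The lower-degree set \<open>G\<close> is arbitrary there because every removal of such a
  polynomial enlarges it.\<close>

theorem has_sign_tables_upoly:
  "finite F \<Longrightarrow> F \<subseteq> upoly I (Suc d) \<Longrightarrow> has_sign_tables I F"
proof (induction d arbitrary: F)
  case 0
  then show ?case by (rule has_sign_tables_const)
next
  case (Suc d)
  have "has_sign_tables I (F \<union> G)" if "finite G" "G \<subseteq> upoly I (Suc d)" for G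
    using Suc.prems that
  proof (induction F arbitrary: G)
    case empty
    then show ?case using Suc.IH by simp
  next
    case (insert q F)
    have "has_sign_tables I (insert q (F \<union> G))"
    proof (rule has_sign_tables_insert)
      show "F \<union> G \<subseteq> upoly I (Suc (Suc d))"
        using insert.prems upoly_Suc_subset[of I "Suc d"] by auto
      show "has_sign_tables I (F \<union> G \<union> G')" if "finite G'" "G' \<subseteq> upoly I (Suc d)" for G'
        using insert.IH[of "G \<union> G'"] insert.prems that by (simp add: Un_assoc)
    qed (use insert in auto)
    then show ?case by simp
  qed
  from this[of "{}"] show ?case by simp
qed

section \<open>Projection\<close>

text \<open>A real number is a listed point, lies in the gap after one, or precedes all of them; on
  a gap each sign is constant.\<close>

lemma sign_table_covers:
  fixes t :: real
  assumes tab: "sign_table \<phi> F xs T" and cont: "\<And>f. f \<in> F \<Longrightarrow> continuous_on UNIV (\<phi> f)"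
  shows "(\<forall>f\<in>F. sgn (\<phi> f t) = fst T f) \<or>
    (\<exists>e\<in>set (snd T). (\<forall>f\<in>F. sgn (\<phi> f t) = fst e f) \<or> (\<forall>f\<in>F. sgn (\<phi> f t) = snd e f))"
proof -
  have roots: "\<And>f t. f \<in> F \<Longrightarrow> \<phi> f t = 0 \<Longrightarrow> t \<in> set xs \<or> (\<forall>s. \<phi> f s = 0)"
    and at_bot: "\<And>f. f \<in> F \<Longrightarrow> \<forall>\<^sub>F t in at_bot. sgn (\<phi> f t) = fst T f"
    and entries: "list_all2 (sign_entry \<phi> F) xs (snd T)"
    using tab unfolding sign_table_def by blast+
  have entry: "\<exists>e\<in>set (snd T). sign_entry \<phi> F x e" if x: "x \<in> set xs" for x
    using entries x by (metis list_all2_conv_all_nth in_set_conv_nth)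
  consider "t \<in> set xs" | "t \<notin> set xs" "\<exists>x\<in>set xs. x < t" | "\<forall>x\<in>set xs. t < x"
    by (metis linorder_less_linear)
  then show ?thesis
  proof cases
    case 1
    then show ?thesis using entry[of t] by (auto simp: sign_entry_def)
  next
    case 2
    \<comment> \<open>The signs at \<open>t\<close> are those recorded just to the right of the last
      listed point before it.\<close>
    define l where "l = Max {x \<in> set xs. x < t}"
    have "l \<in> {x \<in> set xs. x < t}" unfolding l_def by (rule Max_in) (use 2 in auto)
    then have l: "l \<in> set xs" "l < t" by auto
    have l_max: "x \<le> l" if "x \<in> set xs" "x < t" for x using that by (auto simp: l_def)
    obtain r where r: "t < r" "\<And>u. t < u \<Longrightarrow> u < r \<Longrightarrow> u \<notin> set xs"
      using finite_gap_right[of "set xs" t] by auto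
    have gap: "u \<notin> set xs" if "l < u" "u < r" for u
      using l_max[of u] r(2)[of u] 2(1) that by (cases u t rule: linorder_cases) auto
    obtain e where e: "e \<in> set (snd T)" "sign_entry \<phi> F l e" using entry[OF l(1)] by blast
    have "sgn (\<phi> f t) = snd e f" if f: "f \<in> F" for f
    proof -
      have ev: "\<forall>\<^sub>F u in at_right l. sgn (\<phi> f u) = snd e f"
        using e(2) f by (auto simp: sign_entry_def)
      show ?thesis
      proof (cases "\<forall>s. \<phi> f s = 0")
        case True
        then show ?thesis using ev by (simp add: trivial_limit_at_right_real)
      next
        case False
        then have "\<phi> f u \<noteq> 0" if "l < u" "u < r" for u
          using roots[OF f, of u] gap[OF that] by blast
        then show ?thesis
          by (rule sgn_eq_right_sgn[OF cont[OF f] _ ev l(2) r(1)])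
      qed
    qed
    with e(1) show ?thesis by blast
  next
    case 3
    have "sgn (\<phi> f t) = fst T f" if f: "f \<in> F" for f
    proof -
      obtain b where b: "\<And>u. u \<le> b \<Longrightarrow> sgn (\<phi> f u) = fst T f"
        using at_bot[OF f] by (auto simp: eventually_at_bot_linorder)
      show ?thesis
      proof (cases "\<forall>s. \<phi> f s = 0")
        case True
        then show ?thesis using b[of b] by simp
      next
        case False
        obtain r where r: "t < r" "\<And>u. t < u \<Longrightarrow> u < r \<Longrightarrow> u \<notin> set xs"
          using finite_gap_right[of "set xs" t] by auto
        have "u \<notin> set xs" if "u < r" for u
          using r(2)[of u] 3 that by (cases "t < u") force+
        then have nz: "\<phi> f u \<noteq> 0" if "u < r" for u
          using roots[OF f, of u] False that by blast
        have "sgn (\<phi> f t) = sgn (\<phi> f (min b t))"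
          by (rule continuous_nonzero_sgn_eq[OF cont[OF f], of "min b t - 1" r])
            (use nz r(1) in auto)
        also have "\<dots> = fst T f" by (rule b) simp
        finally show ?thesis .
      qed
    qed
    then show ?thesis by blast
  qed
qed

text \<open>Since \<open>F\<close> is finite, its eventual signs hold simultaneously at some
  point.\<close>

lemma sign_table_realized:
  assumes tab: "sign_table \<phi> F xs T" and "finite F"
  shows "\<exists>t. \<forall>f\<in>F. sgn (\<phi> f t) = fst T f"
    and "e \<in> set (snd T) \<Longrightarrow> \<exists>t. \<forall>f\<in>F. sgn (\<phi> f t) = fst e f"
    and "e \<in> set (snd T) \<Longrightarrow> \<exists>t. \<forall>f\<in>F. sgn (\<phi> f t) = snd e f"
proof -
  have "\<forall>\<^sub>F t in at_bot. \<forall>f\<in>F. sgn (\<phi> f t) = fst T f"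
    using tab \<open>finite F\<close> by (intro eventually_ball_finite) (auto simp: sign_table_def)
  then show "\<exists>t. \<forall>f\<in>F. sgn (\<phi> f t) = fst T f"
    by (auto simp: eventually_at_bot_linorder)
  assume "e \<in> set (snd T)"
  then obtain x where e: "sign_entry \<phi> F x e"
    using tab by (auto simp: sign_table_def list_all2_conv_all_nth in_set_conv_nth)
  then show "\<exists>t. \<forall>f\<in>F. sgn (\<phi> f t) = fst e f" by (auto simp: sign_entry_def)
  have "\<forall>\<^sub>F t in at_right x. \<forall>f\<in>F. sgn (\<phi> f t) = snd e f"
    using e \<open>finite F\<close> by (intro eventually_ball_finite) (auto simp: sign_entry_def)
  then show "\<exists>t. \<forall>f\<in>F. sgn (\<phi> f t) = snd e f"
    using eventually_happens[of _ "at_right x"] by (auto simp: trivial_limit_at_right_real)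
qed

lemma upoly_single: "a \<in> polyfun I \<Longrightarrow> (\<lambda>x t. a x * t ^ d) \<in> upoly I (Suc d)"
  using upoly_SucI[of "\<lambda>x t. 0" I d a] upoly_mono[of 0 d I] by (auto simp: upoly_0)

lemma upoly_sum:
  assumes "\<And>k. k \<in> K \<Longrightarrow> f k \<in> upoly I d"
  shows "(\<lambda>x t. \<Sum>k\<in>K. f k x t) \<in> upoly I d"
proof -
  have zero: "(\<lambda>x t. 0) \<in> upoly I d" using upoly_mono[of 0 d I] by (auto simp: upoly_0)
  show ?thesis
    using assms by (induction K rule: infinite_finite_induct) (auto intro: upoly_add zero)
qed

text \<open>Each monomial is a power of the variable \<open>j\<close> times a monomial in the
  others, which goes into the coefficient.\<close>

lemma polyfun_imp_upoly:
  assumes "f \<in> polyfun I"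
  shows "\<exists>d. (\<lambda>x t. f (x(j := t))) \<in> upoly (I - {j}) d"
proof -
  obtain p where p: "f = mpoly_eval p" "mpoly_vars p \<subseteq> I" using assms by (auto simp: polyfun_def)
  let ?deg = "\<lambda>m. Poly_Mapping.lookup m j"
  define c where "c = (\<lambda>m (x :: 'a \<Rightarrow> real). Poly_Mapping.lookup p m *
    (\<Prod>i\<in>Poly_Mapping.keys m - {j}. x i ^ Poly_Mapping.lookup m i))"
  define D where "D = Max (?deg ` Poly_Mapping.keys p)"
  have monomial: "(\<lambda>x t. c m x * t ^ ?deg m) \<in> upoly (I - {j}) (Suc D)" if m: "m \<in> Poly_Mapping.keys p" for m
  proof -
    have "c m \<in> polyfun (I - {j})"
      unfolding c_def using p(2) m
      by (intro polyfun_mult polyfun_const polyfun_prod polyfun_power polyfun_coord)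
        (auto simp: mpoly_vars_def)
    moreover have "?deg m \<le> D" using m by (simp add: D_def)
    ultimately show ?thesis using upoly_single upoly_mono[of "Suc (?deg m)" "Suc D"] by fastforce
  qed
  have "f (x(j := t)) = (\<Sum>m\<in>Poly_Mapping.keys p. c m x * t ^ ?deg m)" for x t
    unfolding p(1) mpoly_eval_def
  proof (rule sum.cong[OF refl])
    fix m
    \<comment> \<open>Adding \<open>j\<close>, possibly with exponent zero, allows its factor to be
      split off in every case.\<close>
    have "(\<Prod>i\<in>Poly_Mapping.keys m. (x(j := t)) i ^ Poly_Mapping.lookup m i) =
        (\<Prod>i\<in>insert j (Poly_Mapping.keys m). (x(j := t)) i ^ Poly_Mapping.lookup m i)"
      by (intro prod.mono_neutral_left) (auto simp: in_keys_iff)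
    also have "\<dots> = t ^ ?deg m * (\<Prod>i\<in>Poly_Mapping.keys m - {j}. (x(j := t)) i ^ Poly_Mapping.lookup m i)"
      by (subst prod.insert_remove) auto
    also have "(\<Prod>i\<in>Poly_Mapping.keys m - {j}. (x(j := t)) i ^ Poly_Mapping.lookup m i) =
        (\<Prod>i\<in>Poly_Mapping.keys m - {j}. x i ^ Poly_Mapping.lookup m i)"
      by (intro prod.cong) auto
    finally show "Poly_Mapping.lookup p m *
        (\<Prod>i\<in>Poly_Mapping.keys m. (x(j := t)) i ^ Poly_Mapping.lookup m i) = c m x * t ^ ?deg m"
      by (simp add: c_def)
  qed
  then have "(\<lambda>x t. f (x(j := t))) = (\<lambda>x t. \<Sum>m\<in>Poly_Mapping.keys p. c m x * t ^ ?deg m)"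
    by (simp add: fun_eq_iff)
  moreover have "(\<lambda>x t. \<Sum>m\<in>Poly_Mapping.keys p. c m x * t ^ ?deg m) \<in> upoly (I - {j}) (Suc D)"
    by (rule upoly_sum[OF monomial])
  ultimately show ?thesis by metis
qed

section \<open>Elimination of existential quantifiers\<close>

text \<open>A suitable \<open>t\<close> exists iff the sign table at \<open>x\<close> contains a
  sign vector on which \<open>P\<close> holds, so the answer is a function of the table.\<close>

theorem sign_determined_ex:
  fixes P :: "('i \<Rightarrow> real) \<Rightarrow> bool"
  assumes "sign_determined I P"
  shows "sign_determined (I - {j}) (\<lambda>x. \<exists>t. P (x(j := t)))"
proof -
  obtain F where F: "finite F" "F \<subseteq> polyfun I"
    and P: "\<forall>x y. (\<forall>f\<in>F. sgn (f x) = sgn (f y)) \<longrightarrow> P x = P y"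
    using assms unfolding sign_determined_def by (elim exE conjE)
  define sec where "sec f = (\<lambda>x t. f (x(j := t)))" for f :: "('i \<Rightarrow> real) \<Rightarrow> real"
  have "\<forall>f\<in>F. \<exists>d. sec f \<in> upoly (I - {j}) d"
  proof
    fix f assume "f \<in> F"
    then show "\<exists>d. sec f \<in> upoly (I - {j}) d"
      unfolding sec_def using F(2) by (intro polyfun_imp_upoly) blast
  qed
  from bchoice[OF this] obtain d where d: "\<forall>f\<in>F. sec f \<in> upoly (I - {j}) (d f)" by (rule exE)
  define D where "D = Max (d ` F)"
  have sec_upoly: "sec f \<in> upoly (I - {j}) (Suc D)" if f: "f \<in> F" for f
  proof -
    have "d f \<le> Suc D" using F(1) f by (auto simp: D_def intro: le_SucI)
    then show ?thesis using d f upoly_mono by blast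
  qed
  have "has_sign_tables (I - {j}) (sec ` F)"
    by (rule has_sign_tables_upoly[where d = D]) (use F(1) sec_upoly in auto)
  then obtain T where T: "sign_determined (I - {j}) T"
    and tab: "\<And>x. \<exists>xs. sign_table (\<lambda>f. f x) (sec ` F) xs (T x)"
    by (auto simp: has_sign_tables_def)
  \<comment> \<open>The witness \<open>y\<close> need not agree with \<open>x\<close> outside
    \<open>j\<close>, as \<open>P\<close> depends on the signs only.\<close>
  define W where "W v \<longleftrightarrow> (\<exists>y. P y \<and> (\<forall>f\<in>F. sgn (f y) = v (sec f)))"
    for v :: "(('i \<Rightarrow> real) \<Rightarrow> real \<Rightarrow> real) \<Rightarrow> real"
  define K where "K T' \<longleftrightarrow> W (fst T') \<or> (\<exists>e\<in>set (snd T'). W (fst e) \<or> W (snd e))"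
    for T' :: "(('i \<Rightarrow> real) \<Rightarrow> real \<Rightarrow> real) sign_data"
  have W_iff: "P (x(j := t)) \<longleftrightarrow> W v" if v: "\<forall>f\<in>sec ` F. sgn (f x t) = v f" for x t v
  proof
    assume "P (x(j := t))"
    then show "W v" unfolding W_def using v by (intro exI[of _ "x(j := t)"]) (auto simp: sec_def)
  next
    assume "W v"
    then obtain y where y: "P y" "\<forall>f\<in>F. sgn (f y) = v (sec f)" by (auto simp: W_def)
    have "\<forall>f\<in>F. sgn (f (x(j := t))) = v (sec f)" using v by (auto simp: sec_def)
    with y P[rule_format, of "x(j := t)" y] show "P (x(j := t))" by simp
  qed
  have "(\<exists>t. P (x(j := t))) \<longleftrightarrow> K (T x)" for x
  proof -
    obtain xs where xs: "sign_table (\<lambda>f. f x) (sec ` F) xs (T x)" using tab by blast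
    show ?thesis
    proof
      assume "\<exists>t. P (x(j := t))"
      then obtain t where t: "P (x(j := t))" ..
      have "(\<forall>f\<in>sec ` F. sgn (f x t) = fst (T x) f) \<or>
          (\<exists>e\<in>set (snd (T x)). (\<forall>f\<in>sec ` F. sgn (f x t) = fst e f) \<or> (\<forall>f\<in>sec ` F. sgn (f x t) = snd e f))"
      proof (rule sign_table_covers[OF xs])
        show "continuous_on UNIV (f x)" if "f \<in> sec ` F" for f
          using that sec_upoly upoly_continuous by blast
      qed
      then show "K (T x)"
        unfolding K_def using W_iff[of x t] t by blast
    next
      assume K: "K (T x)"
      have realize: "\<exists>t. P (x(j := t))" if "W v" "\<exists>t. \<forall>f\<in>sec ` F. sgn (f x t) = v f" for v
        using that W_iff by blast
      have fin: "finite (sec ` F)" using F(1) by simp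
      from K consider "W (fst (T x))"
        | e where "e \<in> set (snd (T x))" "W (fst e)" | e where "e \<in> set (snd (T x))" "W (snd e)"
        unfolding K_def by blast
      then show "\<exists>t. P (x(j := t))"
        by cases (erule realize, (rule sign_table_realized[OF xs fin]; assumption))+
    qed
  qed
  then show ?thesis using sign_determined_compose[OF T, of K] by simp
qed

text \<open>Variables are eliminated one at a time; only the values of \<open>z\<close> on
  \<open>V\<close> enter.\<close>

lemma sign_determined_ex_finite:
  assumes "finite V" "sign_determined I P"
  shows "sign_determined (I - V) (\<lambda>x. \<exists>z. P (\<lambda>i. if i \<in> V then z i else x i))"
  using assms(1)
proof (induction V)
  case empty
  then show ?case using assms(2) by simp
next
  case (insert j V)
  have "(\<exists>t z. P (\<lambda>i. if i \<in> V then z i else (x(j := t)) i)) \<longleftrightarrow>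
      (\<exists>z. P (\<lambda>i. if i \<in> insert j V then z i else x i))" for x
  proof
    assume "\<exists>t z. P (\<lambda>i. if i \<in> V then z i else (x(j := t)) i)"
    then obtain t z where "P (\<lambda>i. if i \<in> V then z i else (x(j := t)) i)" by blast
    moreover have "(\<lambda>i. if i \<in> V then z i else (x(j := t)) i) =
        (\<lambda>i. if i \<in> insert j V then (z(j := t)) i else x i)"
      using insert.hyps by auto
    ultimately show "\<exists>z. P (\<lambda>i. if i \<in> insert j V then z i else x i)" by metis
  next
    assume "\<exists>z. P (\<lambda>i. if i \<in> insert j V then z i else x i)"
    then obtain z where "P (\<lambda>i. if i \<in> insert j V then z i else x i)" ..
    moreover have "(\<lambda>i. if i \<in> insert j V then z i else x i) =
        (\<lambda>i. if i \<in> V then z i else (x(j := z j)) i)"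
      by auto
    ultimately show "\<exists>t z. P (\<lambda>i. if i \<in> V then z i else (x(j := t)) i)" by metis
  qed
  with sign_determined_ex[OF insert.IH, of j] show ?case
    by (simp add: Diff_insert2[symmetric] Diff_insert[symmetric])
qed

section \<open>R0-tensors\<close>

text \<open>The vector \<open>x\<close> is encoded by variables indexed by lists of length one, which are no indices
  of an \<open>m\<close>-th order tensor because \<open>m \<noteq> 1\<close>.\<close>

theorem proposition3p2:
  fixes m n :: nat
  assumes "m \<ge> 2" and "n \<ge> 2"
  shows "semialgebraic (multi_indices m n) (R0_set m n)"
proof -
  let ?M = "multi_indices m n"
  define V where "V = (\<lambda>i::nat. [i]) ` {1..n}"
  have "finite V" by (simp add: V_def)
  have "?M \<inter> V = {}" using assms(1) by (auto simp: V_def multi_indices_def)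
  have Cons_M: "i # js \<in> ?M" if "i \<in> {1..n}" "js \<in> multi_indices (m - 1) n" for i js
    using that assms(1) by (auto simp: multi_indices_def)
  \<comment> \<open>Matrix-free form of \<open>tensor_apply\<close> in which tensor entries and
    vector coordinates are variables of one point \<open>y\<close>.\<close>
  define app where "app = (\<lambda>(y :: nat list \<Rightarrow> real) i.
    \<Sum>js\<in>multi_indices (m - 1) n. y (i # js) * (\<Prod>j\<leftarrow>js. y [j]))"
  have coord: "(\<lambda>y. y [i]) \<in> polyfun (?M \<union> V)" if "i \<in> {1..n}" for i
    using that by (intro polyfun_coord) (auto simp: V_def)
  have app: "(\<lambda>y. app y i) \<in> polyfun (?M \<union> V)" if i: "i \<in> {1..n}" for i
    unfolding app_def
  proof (intro polyfun_sum polyfun_mult polyfun_prod_list)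
    fix js assume js: "js \<in> multi_indices (m - 1) n"
    show "(\<lambda>y. y (i # js)) \<in> polyfun (?M \<union> V)"
      using Cons_M[OF i js] by (intro polyfun_coord) auto
    show "(\<lambda>y. y [j]) \<in> polyfun (?M \<union> V)" if "j \<in> set js" for j
      using js that by (intro coord) (auto simp: multi_indices_def)
  qed
  \<comment> \<open>Says that the encoded vector is a nonzero solution for the encoded tensor and
    zero vector \<open>a\<close>.\<close>
  define P where "P y \<longleftrightarrow> (\<forall>i\<in>{1..n}. y [i] \<ge> 0) \<and> (\<forall>i\<in>{1..n}. app y i \<ge> 0) \<and>
    (\<Sum>i=1..n. y [i] * app y i) = 0 \<and> \<not> (\<forall>i\<in>{1..n}. y [i] = 0)" for y
  have "sign_determined (?M \<union> V) P"
    unfolding P_def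
    by (intro sign_determined_compose2[where h = "(\<and>)"] sign_determined_compose[where h = Not]
        sign_determined_ball sign_determined_ge_0 sign_determined_eq_0 polyfun_sum polyfun_mult coord app) auto
  from sign_determined_compose[OF sign_determined_ex_finite[OF \<open>finite V\<close> this], where h = Not]
  have det: "sign_determined ?M (\<lambda>A. \<not> (\<exists>z. P (\<lambda>i. if i \<in> V then z i else A i)))"
    using \<open>?M \<inter> V = {}\<close> by (simp add: Un_Diff Diff_triv)
  \<comment> \<open>As \<open>m - 1\<close> is positive, every product contains a coordinate of the
    zero vector. So being an R0-tensor means having no nonzero solution.\<close>
  have zero: "zero_vector n \<in> TCP_Sol m n A (zero_vector n)" for A
  proof -
    have "tensor_apply m n A (zero_vector n) i = 0" if "i \<in> {1..n}" for i
    proof -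
      have "(\<Prod>j\<leftarrow>js. zero_vector n j) = 0" if js: "js \<in> multi_indices (m - 1) n" for js
      proof -
        obtain j js' where "js = j # js'" "j \<in> {1..n}"
          using js assms(1) by (cases js) (auto simp: multi_indices_def)
        then show ?thesis by (simp add: zero_vector_def)
      qed
      then show ?thesis using that by (simp add: tensor_apply_def)
    qed
    then show ?thesis
      by (auto simp: TCP_Sol_def real_vectors_def coord_space_def zero_vector_def tensor_form_def inner_vec_def)
  qed
  have "R0_tensor m n A \<longleftrightarrow> \<not> (\<exists>z. P (\<lambda>i. if i \<in> V then z i else A i))" for A
  proof -
    have P_iff: "P (\<lambda>i. if i \<in> V then z i else A i) \<longleftrightarrow>
        x \<in> TCP_Sol m n A (zero_vector n) \<and> x \<noteq> zero_vector n"
      if z: "\<And>i. i \<in> {1..n} \<Longrightarrow> z [i] = x i" and x: "x \<in> real_vectors n" for z x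
    proof -
      let ?y = "\<lambda>i. if i \<in> V then z i else A i"
      have y: "?y [i] = x i" if "i \<in> {1..n}" for i using z[OF that] that by (auto simp: V_def)
      have "app ?y i = tensor_apply m n A x i" if i: "i \<in> {1..n}" for i
      proof -
        have "?y (i # js) * (\<Prod>j\<leftarrow>js. ?y [j]) = A (i # js) * (\<Prod>j\<leftarrow>js. x j)"
          if js: "js \<in> multi_indices (m - 1) n" for js
        proof -
          have "i # js \<notin> V" using Cons_M[OF i js] \<open>?M \<inter> V = {}\<close> by blast
          then have "?y (i # js) = A (i # js)" by simp
          moreover have "map (\<lambda>j. ?y [j]) js = map x js"
          proof (rule map_cong[OF refl y])
            show "j \<in> {1..n}" if "j \<in> set js" for j
              using js that by (auto simp: multi_indices_def)
          qed
          ultimately show ?thesis by (simp only:)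
        qed
        then show ?thesis unfolding app_def tensor_apply_def using i by simp
      qed
      moreover have "x = zero_vector n \<longleftrightarrow> (\<forall>i\<in>{1..n}. x i = 0)"
        using x by (auto simp: zero_vector_def real_vectors_def coord_space_def PiE_def extensional_def fun_eq_iff)
      ultimately show ?thesis
        using x y by (simp add: P_def TCP_Sol_def tensor_form_def inner_vec_def zero_vector_def)
    qed
    have "(\<exists>z. P (\<lambda>i. if i \<in> V then z i else A i)) \<longleftrightarrow>
        (\<exists>x\<in>TCP_Sol m n A (zero_vector n). x \<noteq> zero_vector n)"
    proof
      assume "\<exists>z. P (\<lambda>i. if i \<in> V then z i else A i)"
      then obtain z where z: "P (\<lambda>i. if i \<in> V then z i else A i)" ..
      show "\<exists>x\<in>TCP_Sol m n A (zero_vector n). x \<noteq> zero_vector n"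
        using z P_iff[of z "\<lambda>i\<in>{1..n}. z [i]"] by (auto simp: real_vectors_def coord_space_def)
    next
      assume "\<exists>x\<in>TCP_Sol m n A (zero_vector n). x \<noteq> zero_vector n"
      then obtain x where x: "x \<in> TCP_Sol m n A (zero_vector n)" "x \<noteq> zero_vector n" by blast
      then have "x \<in> real_vectors n" by (simp add: TCP_Sol_def)
      \<comment> \<open>The map \<open>hd\<close> undoes the encoding of \<open>i\<close> as
        \<open>[i]\<close>.\<close>
      then show "\<exists>z. P (\<lambda>i. if i \<in> V then z i else A i)"
        using P_iff[of "\<lambda>is. x (hd is)" x] x by auto
    qed
    then show ?thesis using zero unfolding R0_tensor_def by blast
  qed
  then have "R0_set m n = {A \<in> coord_space ?M. \<not> (\<exists>z. P (\<lambda>i. if i \<in> V then z i else A i))}"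
    by (simp add: R0_set_def tensors_def)
  then show ?thesis using sign_determined_imp_semialgebraic[OF det] by simp
qed

end
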